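(* Let $\mathcal B$ be either the category $\mathcal R(\sigma)$ of $\sigma$-structures, for a fixed relational signature $\sigma$, or the category $\mathbf{Graph}$ of graphs. Let $\Delta$ be a component-based class of finite objects of $\mathcal B$, let $\mathbb D_\Delta$ be the discrete density comonad of $\Delta$ (defined in the context), and let $\mathbb C$ be a comonad on $\mathcal B$ that classifies a class $\Gamma$ of finite objects of $\mathcal B$. Then $\Delta\subseteq\Gamma$ if and only if there exists a comonad morphism $\mathbb D_\Delta\Rightarrow\mathbb C$.
   Context: A relational signature $\sigma$ is a set of relation symbols of positive finite arity. Objects of $\mathcal R(\sigma)$ are arbitrary (possibly infinite or empty) $\sigma$-structures with homomorphisms (relation-preserving functions). Objects of $\mathbf{Graph}$ are undirected loopless graphs (possibly infinite or empty), with edge-preserving functions. Coproducts are disjoint unions. A class $\Delta$ of finite objects is component-based if it is closed under isomorphisms, under finite coproducts (including the empty one), and under summands (if $A+B\in\Delta$ then $A,B\in\Delta$). An object $C$ is connected if every morphism $C\to\coprod_i A_i$ into a coproduct factors uniquely through exactly one of the coproduct inclusions (for $\mathcal R(\sigma)$: nonempty with connected Gaifman graph; for $\mathbf{Graph}$: nonempty connected graphs). The comonad $\mathbb D_\Delta$: let $\mathcal A$ be a set consisting of exactly one representative of each isomorphism class of connected objects in $\Delta$. For an object $B$ put $\mathbb D_\Delta(B)=\coprod_{A\in\mathcal A}\coprod_{f\colon A\to B}A$, with $\iota_f\colon A\to\mathbb D_\Delta(B)$ the inclusion of the summand indexed by $f\colon A\to B$. For $h\colon B\to B'$, $\mathbb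 D_\Delta(h)\circ\iota_f=\iota_{h\circ f}$; the counit and comultiplication are determined by $\varepsilon_B\circ\iota_f=f$ and $\delta_B\circ\iota_f=\iota_{\iota_f}$. (This is the density comonad of the inclusion of the discrete category $\mathcal A$ into $\mathcal B$.) A coalgebra for a comonad $(\mathbb C,\varepsilon,\delta)$ on $X$ is a morphism $\alpha\colon X\to\mathbb C(X)$ with $\varepsilon_X\circ\alpha=\mathrm{id}$ and $\delta_X\circ\alpha=\mathbb C(\alpha)\circ\alpha$. $\mathbb C$ classifies a class $\Gamma$ if for every finite object $X$: $X\in\Gamma$ iff $X$ admits a $\mathbb C$-coalgebra. A comonad morphism $\lambda\colon\mathbb D\Rightarrow\mathbb C$ is a natural transformation with $\varepsilon^{\mathbb C}\circ\lambda=\varepsilon^{\mathbb D}$ and $\delta^{\mathbb C}\circ\lambda=\lambda\mathbb C\circ\mathbb D\lambda\circ\delta^{\mathbb D}$. *)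

theory Defs
  imports Main "HOL-Library.FuncSet" "HOL-Library.Equipollence"
begin

section \<open>Categories, coproducts, comonads\<close>

text \<open>A category together with the underlying-set map \<^term>\<open>Und\<close> of its objects.\<close>

record ('o, 'm, 'u) category =
  Ob :: "'o set"
  Arr :: "'m set"
  Dom :: "'m \<Rightarrow> 'o"
  Cod :: "'m \<Rightarrow> 'o"
  Ident :: "'o \<Rightarrow> 'm"
  Comp :: "'m \<Rightarrow> 'm \<Rightarrow> 'm"
  Und :: "'o \<Rightarrow> 'u set"

definition Hom :: "('o, 'm, 'u) category \<Rightarrow> 'o \<Rightarrow> 'o \<Rightarrow> 'm set" where
  "Hom B X Y = {f \<in> Arr B. Dom B f = X \<and> Cod B f = Y}"

definition fin_ob :: "('o, 'm, 'u) category \<Rightarrow> 'o set" where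
  "fin_ob B = {X \<in> Ob B. finite (Und B X)}"

definition isomorphic :: "('o, 'm, 'u) category \<Rightarrow> 'o \<Rightarrow> 'o \<Rightarrow> bool" where
  "isomorphic B X Y \<longleftrightarrow>
     (\<exists>f \<in> Hom B X Y. \<exists>g \<in> Hom B Y X. Comp B g f = Ident B X \<and> Comp B f g = Ident B Y)"

definition is_coproduct ::
  "('o, 'm, 'u) category \<Rightarrow> 'i set \<Rightarrow> ('i \<Rightarrow> 'o) \<Rightarrow> 'o \<Rightarrow> ('i \<Rightarrow> 'm) \<Rightarrow> bool" where
  "is_coproduct B I F P \<iota> \<longleftrightarrow>
     P \<in> Ob B \<and> (\<forall>i\<in>I. F i \<in> Ob B \<and> \<iota> i \<in> Hom B (F i) P) \<and>
     (\<forall>Q \<in> Ob B. \<forall>g. (\<forall>i\<in>I. g i \<in> Hom B (F i) Q) \<longrightarrow>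
        (\<exists>!u. u \<in> Hom B P Q \<and> (\<forall>i\<in>I. Comp B u (\<iota> i) = g i)))"

text \<open>A chosen coproduct object with its inclusions; meaningful only if a coproduct exists.\<close>

definition coproduct ::
  "('o, 'm, 'u) category \<Rightarrow> 'i set \<Rightarrow> ('i \<Rightarrow> 'o) \<Rightarrow> 'o \<times> ('i \<Rightarrow> 'm)" where
  "coproduct B I F = (SOME (P, \<iota>). is_coproduct B I F P \<iota>)"

text \<open>A pair \<open>(i, g)\<close> is a factorisation of \<open>f\<close> through the inclusion \<open>\<iota> i\<close>.\<close>

definition connected_ob ::
  "('u set \<Rightarrow> bool) \<Rightarrow> ('o, 'm, 'u) category \<Rightarrow> 'o \<Rightarrow> bool" where
  "connected_ob small B X \<longleftrightarrow> X \<in> Ob B \<and>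
     (\<forall>(I :: 'u set) F P \<iota> f. small I \<and> is_coproduct B I F P \<iota> \<and> f \<in> Hom B X P \<longrightarrow>
        (\<exists>!(i, g). i \<in> I \<and> g \<in> Hom B X (F i) \<and> Comp B (\<iota> i) g = f))"

definition component_based :: "('o, 'm, 'u) category \<Rightarrow> 'o set \<Rightarrow> bool" where
  "component_based B \<Delta> \<longleftrightarrow> \<Delta> \<subseteq> fin_ob B \<and>
     (\<forall>X Y. X \<in> \<Delta> \<and> Y \<in> Ob B \<and> isomorphic B X Y \<longrightarrow> Y \<in> \<Delta>) \<and>
     (\<forall>(I :: nat set) F P \<iota>.
        finite I \<and> (\<forall>i\<in>I. F i \<in> \<Delta>) \<and> is_coproduct B I F P \<iota> \<longrightarrow> P \<in> \<Delta>) \<and>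
     (\<forall>X Y P \<iota>. is_coproduct B (UNIV :: bool set) (\<lambda>b. if b then X else Y) P \<iota> \<and> P \<in> \<Delta>
        \<longrightarrow> X \<in> \<Delta> \<and> Y \<in> \<Delta>)"

definition connected_representatives ::
  "('u set \<Rightarrow> bool) \<Rightarrow> ('o, 'm, 'u) category \<Rightarrow> 'o set \<Rightarrow> 'o set \<Rightarrow> bool" where
  "connected_representatives small B \<Delta> \<A> \<longleftrightarrow>
     (\<forall>A\<in>\<A>. A \<in> \<Delta> \<and> connected_ob small B A) \<and>
     (\<forall>X\<in>\<Delta>. connected_ob small B X \<longrightarrow> (\<exists>!A. A \<in> \<A> \<and> isomorphic B X A))"

record ('o, 'm) comonad =
  Fob :: "'o \<Rightarrow> 'o"
  Fmap :: "'m \<Rightarrow> 'm"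
  Counit :: "'o \<Rightarrow> 'm"
  Comult :: "'o \<Rightarrow> 'm"

definition is_functor ::
  "('o, 'm, 'u) category \<Rightarrow> ('o \<Rightarrow> 'o) \<Rightarrow> ('m \<Rightarrow> 'm) \<Rightarrow> bool" where
  "is_functor B T t \<longleftrightarrow>
     (\<forall>X \<in> Ob B. T X \<in> Ob B \<and> t (Ident B X) = Ident B (T X)) \<and>
     (\<forall>f \<in> Arr B. t f \<in> Hom B (T (Dom B f)) (T (Cod B f))) \<and>
     (\<forall>f \<in> Arr B. \<forall>g \<in> Arr B. Dom B g = Cod B f \<longrightarrow> t (Comp B g f) = Comp B (t g) (t f))"

definition is_natural ::
  "('o, 'm, 'u) category \<Rightarrow> ('o \<Rightarrow> 'o) \<Rightarrow> ('m \<Rightarrow> 'm) \<Rightarrow> ('o \<Rightarrow> 'o) \<Rightarrow> ('m \<Rightarrow> 'm)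
     \<Rightarrow> ('o \<Rightarrow> 'm) \<Rightarrow> bool" where
  "is_natural B S s T t \<tau> \<longleftrightarrow>
     (\<forall>X \<in> Ob B. \<tau> X \<in> Hom B (S X) (T X)) \<and>
     (\<forall>f \<in> Arr B. Comp B (t f) (\<tau> (Dom B f)) = Comp B (\<tau> (Cod B f)) (s f))"

definition is_comonad :: "('o, 'm, 'u) category \<Rightarrow> ('o, 'm) comonad \<Rightarrow> bool" where
  "is_comonad B C \<longleftrightarrow>
     is_functor B (Fob C) (Fmap C) \<and>
     is_natural B (Fob C) (Fmap C) (\<lambda>X. X) (\<lambda>f. f) (Counit C) \<and>
     is_natural B (Fob C) (Fmap C) (\<lambda>X. Fob C (Fob C X)) (\<lambda>f. Fmap C (Fmap C f)) (Comult C) \<and>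
     (\<forall>X \<in> Ob B.
        Comp B (Counit C (Fob C X)) (Comult C X) = Ident B (Fob C X) \<and>
        Comp B (Fmap C (Counit C X)) (Comult C X) = Ident B (Fob C X) \<and>
        Comp B (Comult C (Fob C X)) (Comult C X) = Comp B (Fmap C (Comult C X)) (Comult C X))"

definition is_coalgebra ::
  "('o, 'm, 'u) category \<Rightarrow> ('o, 'm) comonad \<Rightarrow> 'o \<Rightarrow> 'm \<Rightarrow> bool" where
  "is_coalgebra B C X \<alpha> \<longleftrightarrow>
     \<alpha> \<in> Hom B X (Fob C X) \<and>
     Comp B (Counit C X) \<alpha> = Ident B X \<and>
     Comp B (Comult C X) \<alpha> = Comp B (Fmap C \<alpha>) \<alpha>"

definition classifies ::
  "('o, 'm, 'u) category \<Rightarrow> ('o, 'm) comonad \<Rightarrow> 'o set \<Rightarrow> bool" where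
  "classifies B C \<Gamma> \<longleftrightarrow> \<Gamma> \<subseteq> fin_ob B \<and> (\<forall>X \<in> fin_ob B. X \<in> \<Gamma> \<longleftrightarrow> (\<exists>\<alpha>. is_coalgebra B C X \<alpha>))"

definition comonad_morphism ::
  "('o, 'm, 'u) category \<Rightarrow> ('o, 'm) comonad \<Rightarrow> ('o, 'm) comonad \<Rightarrow> ('o \<Rightarrow> 'm) \<Rightarrow> bool" where
  "comonad_morphism B D C \<tau> \<longleftrightarrow>
     is_natural B (Fob D) (Fmap D) (Fob C) (Fmap C) \<tau> \<and>
     (\<forall>X \<in> Ob B.
        Comp B (Counit C X) (\<tau> X) = Counit D X \<and>
        Comp B (Comult C X) (\<tau> X) =
          Comp B (\<tau> (Fob C X)) (Comp B (Fmap D (\<tau> X)) (Comult D X)))"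


section \<open>The discrete density comonad\<close>

text \<open>The double coproduct over \<open>A \<in> \<A>\<close> and \<open>f : A \<rightarrow> X\<close> is taken as one coproduct indexed by
  the arrows \<open>f\<close> into \<open>X\<close> with domain in \<open>\<A>\<close>; the summand at \<open>f\<close> is the domain of \<open>f\<close>.\<close>

definition density_index :: "('o, 'm, 'u) category \<Rightarrow> 'o set \<Rightarrow> 'o \<Rightarrow> 'm set" where
  "density_index B \<A> X = {f \<in> Arr B. Dom B f \<in> \<A> \<and> Cod B f = X}"

definition density_ob :: "('o, 'm, 'u) category \<Rightarrow> 'o set \<Rightarrow> 'o \<Rightarrow> 'o" where
  "density_ob B \<A> X = fst (coproduct B (density_index B \<A> X) (Dom B))"

definition density_in :: "('o, 'm, 'u) category \<Rightarrow> 'o set \<Rightarrow> 'm \<Rightarrow> 'm" where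
  "density_in B \<A> f = snd (coproduct B (density_index B \<A> (Cod B f)) (Dom B)) f"

text \<open>The arrow \<open>D(X) \<rightarrow> Q\<close> whose composite with the inclusion at \<open>f\<close> is \<open>g f\<close>.\<close>

definition density_copair ::
  "('o, 'm, 'u) category \<Rightarrow> 'o set \<Rightarrow> 'o \<Rightarrow> 'o \<Rightarrow> ('m \<Rightarrow> 'm) \<Rightarrow> 'm" where
  "density_copair B \<A> X Q g =
     (THE u. u \<in> Hom B (density_ob B \<A> X) Q \<and>
        (\<forall>f \<in> density_index B \<A> X. Comp B u (density_in B \<A> f) = g f))"

definition density_comonad :: "('o, 'm, 'u) category \<Rightarrow> 'o set \<Rightarrow> ('o, 'm) comonad" where
  "density_comonad B \<A> =
     \<lparr> Fob = density_ob B \<A>,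
       Fmap = (\<lambda>h. density_copair B \<A> (Dom B h) (density_ob B \<A> (Cod B h))
                     (\<lambda>f. density_in B \<A> (Comp B h f))),
       Counit = (\<lambda>X. density_copair B \<A> X X (\<lambda>f. f)),
       Comult = (\<lambda>X. density_copair B \<A> X (density_ob B \<A> (density_ob B \<A> X))
                       (\<lambda>f. density_in B \<A> (density_in B \<A> f))) \<rparr>"


section \<open>Universes\<close>

text \<open>The sets of the ambient set theory are modelled by the \<open>small\<close> subsets of a type.
  A Grothendieck universe \<open>U\<close> gives an instance (\<open>'u\<close> being \<open>U\<close> itself and \<open>small X\<close> meaning
  \<open>X \<in> U\<close>). Closure under power sets is not demanded, so for an infinite type it is also
  admissible to count every subset as small.\<close>

definition universe :: "('u set \<Rightarrow> bool) \<Rightarrow> bool" where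
  "universe small \<longleftrightarrow>
     (\<forall>X Y. small X \<and> Y \<lesssim> X \<longrightarrow> small Y) \<and>
     (\<exists>X. small X \<and> infinite X) \<and>
     (\<forall>(I :: 'u set) F. small I \<and> (\<forall>i\<in>I. small (F i)) \<longrightarrow> small (\<Union>i\<in>I. F i))"

lemma universe_all:
  assumes "infinite (UNIV :: 'u set)"
  shows "universe (\<lambda>_ :: 'u set. True)"
  using assms by (auto simp: universe_def)


section \<open>Relational structures and graphs\<close>

record ('o, 'u) arrow =
  src :: 'o
  tgt :: 'o
  fn :: "'u \<Rightarrow> 'u"

definition concrete_category ::
  "'o set \<Rightarrow> ('o \<Rightarrow> 'u set) \<Rightarrow> ('o \<Rightarrow> 'o \<Rightarrow> ('u \<Rightarrow> 'u) \<Rightarrow> bool)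
     \<Rightarrow> ('o, ('o, 'u) arrow, 'u) category" where
  "concrete_category obs und preserves =
     \<lparr> Ob = obs,
       Arr = {f. src f \<in> obs \<and> tgt f \<in> obs \<and> fn f \<in> und (src f) \<rightarrow>\<^sub>E und (tgt f) \<and>
                 preserves (src f) (tgt f) (fn f)},
       Dom = src,
       Cod = tgt,
       Ident = (\<lambda>X. \<lparr> src = X, tgt = X, fn = restrict id (und X) \<rparr>),
       Comp = (\<lambda>g f. \<lparr> src = src f, tgt = tgt g, fn = compose (und (src f)) (fn g) (fn f) \<rparr>),
       Und = und \<rparr>"

text \<open>The second condition says that \<open>\<sigma>\<close> is a set of the universe; it bounds the number of
  isomorphism classes of finite structures by a small set.\<close>

definition signature :: "('u set \<Rightarrow> bool) \<Rightarrow> 's set \<Rightarrow> ('s \<Rightarrow> nat) \<Rightarrow> bool" where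
  "signature small \<sigma> ar \<longleftrightarrow> (\<forall>R\<in>\<sigma>. ar R > 0) \<and> (\<exists>X. small X \<and> Pow \<sigma> \<lesssim> X)"

record ('s, 'u) struct =
  univ :: "'u set"
  rel :: "'s \<Rightarrow> 'u list set"

text \<open>Symbols outside \<open>\<sigma>\<close> get the empty interpretation, so that a \<open>\<sigma>\<close>-structure is determined
  by its universe and its interpretation of \<open>\<sigma>\<close>.\<close>

definition structures ::
  "('u set \<Rightarrow> bool) \<Rightarrow> 's set \<Rightarrow> ('s \<Rightarrow> nat) \<Rightarrow> ('s, 'u) struct set" where
  "structures small \<sigma> ar =
     {A. small (univ A) \<and>
         (\<forall>R\<in>\<sigma>. rel A R \<subseteq> {xs. set xs \<subseteq> univ A \<and> length xs = ar R}) \<and>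
         (\<forall>R. R \<notin> \<sigma> \<longrightarrow> rel A R = {})}"

definition Str ::
  "('u set \<Rightarrow> bool) \<Rightarrow> 's set \<Rightarrow> ('s \<Rightarrow> nat)
     \<Rightarrow> (('s, 'u) struct, (('s, 'u) struct, 'u) arrow, 'u) category" where
  "Str small \<sigma> ar = concrete_category (structures small \<sigma> ar) univ
     (\<lambda>A B f. \<forall>R\<in>\<sigma>. \<forall>xs \<in> rel A R. map f xs \<in> rel B R)"

record 'u graph =
  verts :: "'u set"
  edges :: "('u \<times> 'u) set"

definition graphs :: "('u set \<Rightarrow> bool) \<Rightarrow> 'u graph set" where
  "graphs small =
     {G. small (verts G) \<and> edges G \<subseteq> verts G \<times> verts G \<and> sym (edges G) \<and> irrefl (edges G)}"

definition Graph ::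
  "('u set \<Rightarrow> bool) \<Rightarrow> ('u graph, ('u graph, 'u) arrow, 'u) category" where
  "Graph small = concrete_category (graphs small) verts
     (\<lambda>G H f. \<forall>(x, y) \<in> edges G. (f x, f y) \<in> edges H)"

end

(* Let k_f : A -> D X denote the inclusion indexed by f : A -> X. If every A in the chosen
   representatives carries a C-coalgebra alpha_A, then tau_X k_f = C(f) alpha_A defines a comonad
   morphism D -> C. Conversely, a finite X in Delta is the disjoint union of its connected
   components, each of which is a summand of X, hence lies in Delta and is isomorphic to some
   representative; so X is a coproduct of arrows f : A -> X, the arrows k_f assemble to
   a : X -> D X, and tau_X a is a C-coalgebra.

   That D exists requires its defining coproduct to be small: the representatives are pairwise
   non-isomorphic finite objects, so they embed into the objects living on a fixed countable set. *)

theory Submission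
  imports Defs "HOL-Library.Countable_Set"
begin

section \<open>Comonad morphisms out of a discrete density comonad\<close>

text \<open>The formula for \<open>\<tau>\<close> is forced: naturality gives tau_X k_f = tau_X D(f)
  k_id = C(f) tau_A k_id, so a comonad morphism out of D is determined by its values on identities
  of representatives. For the converse, the arrow a is a coalgebra of D, and comonad morphisms carry
  coalgebras to coalgebras. Two obstacles shape the rest. First, \<open>is_coproduct\<close> and
  \<open>connected_ob\<close> speak only of universal properties, while components are made of
  elements and tuples; a concrete disjoint union is therefore built and compared with an arbitrary
  coproduct. Second, a universe here need not be closed under power sets. Sets of homomorphisms are
  bounded through the finiteness of their domains, and over an infinite signature the finite
  structures are counted inside \<open>Pow \<sigma>\<close>, which the signature condition makes
  small. Structures and graphs differ only in how an object is assembled from its tuples, so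
  everything after the size estimates is done once for both.\<close>

locale cat =
  fixes B :: "('o, 'm, 'u) category"
  assumes arr_ob: "f \<in> Arr B \<Longrightarrow> Dom B f \<in> Ob B \<and> Cod B f \<in> Ob B"
    and ident_in: "X \<in> Ob B \<Longrightarrow> Ident B X \<in> Hom B X X"
    and comp_in: "f \<in> Hom B X Y \<Longrightarrow> g \<in> Hom B Y Z \<Longrightarrow> Comp B g f \<in> Hom B X Z"
    and assoc: "f \<in> Hom B W X \<Longrightarrow> g \<in> Hom B X Y \<Longrightarrow> h \<in> Hom B Y Z \<Longrightarrow>
      Comp B (Comp B h g) f = Comp B h (Comp B g f)"
    and ident_left: "f \<in> Hom B X Y \<Longrightarrow> Comp B (Ident B Y) f = f"
    and ident_right: "f \<in> Hom B X Y \<Longrightarrow> Comp B f (Ident B X) = f"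
begin

abbreviation comp (infixl "\<odot>" 55) where "g \<odot> f \<equiv> Comp B g f"

lemma hom_ob: "f \<in> Hom B X Y \<Longrightarrow> X \<in> Ob B \<and> Y \<in> Ob B"
  using arr_ob by (auto simp: Hom_def)

lemma isomorphic_sym: "isomorphic B X Y \<Longrightarrow> isomorphic B Y X"
  by (auto simp: isomorphic_def)

lemma isomorphic_trans:
  assumes "isomorphic B X Y" "isomorphic B Y Z"
  shows "isomorphic B X Z"
proof -
  obtain f g where fg: "f \<in> Hom B X Y" "g \<in> Hom B Y X" "g \<odot> f = Ident B X" "f \<odot> g = Ident B Y"
    using assms(1) by (auto simp: isomorphic_def)
  obtain h k where hk: "h \<in> Hom B Y Z" "k \<in> Hom B Z Y" "k \<odot> h = Ident B Y" "h \<odot> k = Ident B Z"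
    using assms(2) by (auto simp: isomorphic_def)
  have "(g \<odot> k) \<odot> (h \<odot> f) = g \<odot> (k \<odot> (h \<odot> f))"
    by (rule assoc[OF comp_in[OF fg(1) hk(1)] hk(2) fg(2)])
  also have "k \<odot> (h \<odot> f) = f"
    using assoc[OF fg(1) hk(1,2)] hk(3) ident_left[OF fg(1)] by simp
  finally have 1: "(g \<odot> k) \<odot> (h \<odot> f) = Ident B X"
    using fg(3) by simp
  have "(h \<odot> f) \<odot> (g \<odot> k) = h \<odot> (f \<odot> (g \<odot> k))"
    by (rule assoc[OF comp_in[OF hk(2) fg(2)] fg(1) hk(1)])
  also have "f \<odot> (g \<odot> k) = k"
    using assoc[OF hk(2) fg(2,1)] fg(4) ident_left[OF hk(2)] by simp
  finally have 2: "(h \<odot> f) \<odot> (g \<odot> k) = Ident B Z"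
    using hk(4) by simp
  show ?thesis
    unfolding isomorphic_def using 1 2 comp_in[OF fg(1) hk(1)] comp_in[OF hk(2) fg(2)] by blast
qed

text \<open>The uniqueness half of the universal property. Every equation between arrows out of D X
  or out of a decomposed X is checked with it, one inclusion at a time.\<close>

lemma coproduct_ext:
  assumes P: "is_coproduct B I F P \<iota>" and u: "u \<in> Hom B P Q" and v: "v \<in> Hom B P Q"
    and eq: "\<And>i. i \<in> I \<Longrightarrow> u \<odot> \<iota> i = v \<odot> \<iota> i"
  shows "u = v"
proof -
  have "\<forall>i\<in>I. u \<odot> \<iota> i \<in> Hom B (F i) Q"
    using P u comp_in by (auto simp: is_coproduct_def)
  then have "\<exists>!w. w \<in> Hom B P Q \<and> (\<forall>i\<in>I. w \<odot> \<iota> i = u \<odot> \<iota> i)"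
    using P hom_ob[OF u] by (simp add: is_coproduct_def)
  then show ?thesis
    using u v eq by metis
qed

text \<open>Composition with \<open>e i\<close> and \<open>d i\<close> translates cocones on
  \<open>G\<close> into cocones on \<open>F\<close> and back, so the universal property carries
  over. It serves to replace the components of an object by their chosen representatives.\<close>

lemma coproduct_iso_summands:
  assumes P: "is_coproduct B I F P \<iota>"
    and e: "\<And>i. i \<in> I \<Longrightarrow> e i \<in> Hom B (G i) (F i)"
    and d: "\<And>i. i \<in> I \<Longrightarrow> d i \<in> Hom B (F i) (G i)"
    and ed: "\<And>i. i \<in> I \<Longrightarrow> e i \<odot> d i = Ident B (F i)"
    and de: "\<And>i. i \<in> I \<Longrightarrow> d i \<odot> e i = Ident B (G i)"
  shows "is_coproduct B I G P (\<lambda>i. \<iota> i \<odot> e i)"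
proof -
  have \<iota>: "\<iota> i \<in> Hom B (F i) P" if "i \<in> I" for i
    using P that by (simp add: is_coproduct_def)
  have iff: "u \<odot> (\<iota> i \<odot> e i) = g \<longleftrightarrow> u \<odot> \<iota> i = g \<odot> d i"
    if "i \<in> I" "u \<in> Hom B P Q" "g \<in> Hom B (G i) Q" for u i g Q
  proof
    assume "u \<odot> (\<iota> i \<odot> e i) = g"
    then have "(u \<odot> \<iota> i) \<odot> e i = g"
      using assoc[OF e \<iota> that(2)] that(1) by simp
    then show "u \<odot> \<iota> i = g \<odot> d i"
      using assoc[OF d[OF that(1)] e[OF that(1)] comp_in[OF \<iota>[OF that(1)] that(2)]] that(1) ed
        ident_right[OF comp_in[OF \<iota>[OF that(1)] that(2)]] by simp
  next
    assume "u \<odot> \<iota> i = g \<odot> d i"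
    then have "(u \<odot> \<iota> i) \<odot> e i = g"
      using assoc[OF e[OF that(1)] d[OF that(1)] that(3)] that(1) de ident_right[OF that(3)] by simp
    then show "u \<odot> (\<iota> i \<odot> e i) = g"
      using assoc[OF e \<iota> that(2)] that(1) by simp
  qed
  have "\<exists>!u. u \<in> Hom B P Q \<and> (\<forall>i\<in>I. u \<odot> (\<iota> i \<odot> e i) = g i)"
    if Q: "Q \<in> Ob B" and g: "\<forall>i\<in>I. g i \<in> Hom B (G i) Q" for Q g
  proof -
    have "\<forall>i\<in>I. g i \<odot> d i \<in> Hom B (F i) Q"
      using g d comp_in by blast
    then have "\<exists>!u. u \<in> Hom B P Q \<and> (\<forall>i\<in>I. u \<odot> \<iota> i = g i \<odot> d i)"
      using P Q by (simp add: is_coproduct_def)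
    moreover have "(u \<in> Hom B P Q \<and> (\<forall>i\<in>I. u \<odot> (\<iota> i \<odot> e i) = g i)) \<longleftrightarrow>
        (u \<in> Hom B P Q \<and> (\<forall>i\<in>I. u \<odot> \<iota> i = g i \<odot> d i))" for u
      using iff g by blast
    ultimately show ?thesis
      by simp
  qed
  moreover have "G i \<in> Ob B" "\<iota> i \<odot> e i \<in> Hom B (G i) P" if "i \<in> I" for i
    using hom_ob[OF e[OF that]] comp_in[OF e[OF that] \<iota>[OF that]] by auto
  moreover have "P \<in> Ob B"
    using P by (simp add: is_coproduct_def)
  ultimately show ?thesis
    by (simp add: is_coproduct_def)
qed

lemma coproduct_copair:
  assumes "is_coproduct B I F P \<iota>" "Q \<in> Ob B" "\<And>i. i \<in> I \<Longrightarrow> g i \<in> Hom B (F i) Q"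
  obtains u where "u \<in> Hom B P Q" "\<And>i. i \<in> I \<Longrightarrow> u \<odot> \<iota> i = g i"
proof -
  have "\<exists>!u. u \<in> Hom B P Q \<and> (\<forall>i\<in>I. u \<odot> \<iota> i = g i)"
    using assms by (simp add: is_coproduct_def)
  then show ?thesis
    using that by blast
qed

end

text \<open>\<open>coproduct\<close> is a choice by SOME and says nothing unless a coproduct exists;
  \<open>has_density\<close> is thus the one condition under which the definition of D yields the
  intended objects and arrows.\<close>

locale density = cat +
  fixes \<A> :: "'a set"
  assumes has_density:
    "X \<in> Ob B \<Longrightarrow> \<exists>P \<iota>. is_coproduct B (density_index B \<A> X) (Dom B) P \<iota>"
begin

abbreviation "ix \<equiv> density_index B \<A>"
abbreviation "inc \<equiv> density_in B \<A>"
abbreviation "D \<equiv> density_comonad B \<A>"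

lemma ix_iff: "f \<in> ix X \<longleftrightarrow> f \<in> Hom B (Dom B f) X \<and> Dom B f \<in> \<A>"
  by (auto simp: density_index_def Hom_def)

lemma ix_comp: "f \<in> ix X \<Longrightarrow> h \<in> Hom B X Y \<Longrightarrow> h \<odot> f \<in> ix Y \<and> Dom B (h \<odot> f) = Dom B f"
  using comp_in[of f "Dom B f" X h Y] by (auto simp: density_index_def Hom_def)

text \<open>\<open>density_in\<close> finds its coproduct from the codomain of the arrow. On
  \<open>ix X\<close> this codomain is X, so the single function \<open>inc\<close> gives the
  inclusions for all objects at once.\<close>

lemma density_coproduct:
  assumes "X \<in> Ob B"
  shows "is_coproduct B (ix X) (Dom B) (Fob D X) inc"
proof -
  have "case coproduct B (ix X) (Dom B) of (P, \<iota>) \<Rightarrow> is_coproduct B (ix X) (Dom B) P \<iota>"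
    unfolding coproduct_def by (rule someI_ex) (use has_density[OF assms] in auto)
  then have *: "is_coproduct B (ix X) (Dom B) (density_ob B \<A> X)
      (snd (coproduct B (ix X) (Dom B)))"
    by (simp add: density_ob_def case_prod_beta)
  have "inc f = snd (coproduct B (ix X) (Dom B)) f" if "f \<in> ix X" for f
    using that by (simp add: density_in_def density_index_def)
  then show ?thesis
    using * by (simp add: is_coproduct_def density_comonad_def)
qed

lemma D_ob: "X \<in> Ob B \<Longrightarrow> Fob D X \<in> Ob B"
  using density_coproduct by (auto simp: is_coproduct_def)

lemma inc_in: "X \<in> Ob B \<Longrightarrow> f \<in> ix X \<Longrightarrow> inc f \<in> Hom B (Dom B f) (Fob D X)"
  using density_coproduct by (auto simp: is_coproduct_def)

text \<open>An inclusion has a representative as domain, so it is itself an index over D X. This is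
  what gives \<open>inc (inc f)\<close> a meaning in the comultiplication.\<close>

lemma inc_ix:
  assumes "X \<in> Ob B" "f \<in> ix X"
  shows "inc f \<in> ix (Fob D X) \<and> Dom B (inc f) = Dom B f"
  using inc_in[OF assms] assms(2) by (auto simp: density_index_def Hom_def)

lemma copair:
  assumes "X \<in> Ob B" "Q \<in> Ob B" "\<And>f. f \<in> ix X \<Longrightarrow> g f \<in> Hom B (Dom B f) Q"
  shows "density_copair B \<A> X Q g \<in> Hom B (Fob D X) Q"
    and "f \<in> ix X \<Longrightarrow> density_copair B \<A> X Q g \<odot> inc f = g f"
proof -
  have "\<exists>!u. u \<in> Hom B (density_ob B \<A> X) Q \<and> (\<forall>f \<in> ix X. u \<odot> inc f = g f)"
    using density_coproduct[OF assms(1)] assms(2,3)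
    by (simp add: is_coproduct_def density_comonad_def)
  from theI'[OF this]
  show "density_copair B \<A> X Q g \<in> Hom B (Fob D X) Q"
    and "f \<in> ix X \<Longrightarrow> density_copair B \<A> X Q g \<odot> inc f = g f"
    by (simp_all add: density_copair_def density_comonad_def)
qed

lemma D_map:
  assumes "h \<in> Hom B X Y"
  shows "Fmap D h \<in> Hom B (Fob D X) (Fob D Y)"
    and "f \<in> ix X \<Longrightarrow> Fmap D h \<odot> inc f = inc (h \<odot> f)"
proof -
  have h: "Dom B h = X" "Cod B h = Y" "X \<in> Ob B" "Y \<in> Ob B"
    using assms hom_ob[OF assms] by (auto simp: Hom_def)
  have eq: "Fmap D h = density_copair B \<A> X (Fob D Y) (\<lambda>f. inc (h \<odot> f))"
    by (simp add: density_comonad_def h)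
  have g: "inc (h \<odot> f) \<in> Hom B (Dom B f) (Fob D Y)" if "f \<in> ix X" for f
    using inc_in[OF h(4)] ix_comp[OF that assms] by metis
  show "Fmap D h \<in> Hom B (Fob D X) (Fob D Y)"
    unfolding eq by (rule copair(1)[OF h(3) D_ob[OF h(4)] g])
  show "f \<in> ix X \<Longrightarrow> Fmap D h \<odot> inc f = inc (h \<odot> f)"
    unfolding eq by (rule copair(2)[OF h(3) D_ob[OF h(4)] g])
qed

lemma D_counit:
  assumes "X \<in> Ob B"
  shows "Counit D X \<in> Hom B (Fob D X) X"
    and "f \<in> ix X \<Longrightarrow> Counit D X \<odot> inc f = f"
proof -
  have eq: "Counit D X = density_copair B \<A> X X (\<lambda>f. f)"
    by (simp add: density_comonad_def)
  have g: "f \<in> Hom B (Dom B f) X" if "f \<in> ix X" for f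
    using that by (simp add: ix_iff)
  show "Counit D X \<in> Hom B (Fob D X) X"
    unfolding eq by (rule copair(1)[OF assms assms g])
  show "f \<in> ix X \<Longrightarrow> Counit D X \<odot> inc f = f"
    unfolding eq by (rule copair(2)[OF assms assms g])
qed

lemma D_comult:
  assumes "X \<in> Ob B"
  shows "Comult D X \<in> Hom B (Fob D X) (Fob D (Fob D X))"
    and "f \<in> ix X \<Longrightarrow> Comult D X \<odot> inc f = inc (inc f)"
proof -
  have eq: "Comult D X = density_copair B \<A> X (Fob D (Fob D X)) (\<lambda>f. inc (inc f))"
    by (simp add: density_comonad_def)
  have g: "inc (inc f) \<in> Hom B (Dom B f) (Fob D (Fob D X))" if "f \<in> ix X" for f
    using inc_in[OF D_ob[OF assms]] inc_ix[OF assms that] by metis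
  show "Comult D X \<in> Hom B (Fob D X) (Fob D (Fob D X))"
    unfolding eq by (rule copair(1)[OF assms D_ob[OF D_ob[OF assms]] g])
  show "f \<in> ix X \<Longrightarrow> Comult D X \<odot> inc f = inc (inc f)"
    unfolding eq by (rule copair(2)[OF assms D_ob[OF D_ob[OF assms]] g])
qed

section \<open>Comonad morphisms out of the density comonad and coalgebras\<close>

context
  fixes C :: "('a, 'b) comonad"
  assumes C: "is_comonad B C"
begin

lemma C_ob: "X \<in> Ob B \<Longrightarrow> Fob C X \<in> Ob B"
  using C by (simp add: is_comonad_def is_functor_def)

lemma C_map: "f \<in> Hom B X Y \<Longrightarrow> Fmap C f \<in> Hom B (Fob C X) (Fob C Y)"
  using C by (auto simp: is_comonad_def is_functor_def Hom_def)

lemma C_map_comp: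
  "f \<in> Hom B X Y \<Longrightarrow> g \<in> Hom B Y Z \<Longrightarrow> Fmap C (g \<odot> f) = Fmap C g \<odot> Fmap C f"
  using C by (auto simp: is_comonad_def is_functor_def Hom_def)

lemma C_counit: "X \<in> Ob B \<Longrightarrow> Counit C X \<in> Hom B (Fob C X) X"
  using C by (simp add: is_comonad_def is_natural_def)

lemma C_counit_natural: "f \<in> Hom B X Y \<Longrightarrow> Counit C Y \<odot> Fmap C f = f \<odot> Counit C X"
  using C by (auto simp: is_comonad_def is_natural_def Hom_def)

lemma C_comult: "X \<in> Ob B \<Longrightarrow> Comult C X \<in> Hom B (Fob C X) (Fob C (Fob C X))"
  using C by (simp add: is_comonad_def is_natural_def)

lemma C_comult_natural:
  "f \<in> Hom B X Y \<Longrightarrow> Comult C Y \<odot> Fmap C f = Fmap C (Fmap C f) \<odot> Comult C X"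
  using C by (auto simp: is_comonad_def is_natural_def Hom_def)

text \<open>On the summand at \<open>f\<close>, naturality comes from functoriality of C alone, the
  counit condition from the counit law of \<open>\<alpha>\<close> and naturality of the counit, and
  the comultiplication condition from the coassociativity law of \<open>\<alpha>\<close> and
  naturality of the comultiplication.\<close>

lemma comonad_morphism_from_coalgebras:
  assumes \<alpha>: "\<And>A. A \<in> \<A> \<Longrightarrow> is_coalgebra B C A (\<alpha> A)"
  shows "\<exists>\<tau>. comonad_morphism B D C \<tau>"
proof -
  define c where "c f = Fmap C f \<odot> \<alpha> (Dom B f)" for f
  define \<tau> where "\<tau> X = density_copair B \<A> X (Fob C X) c" for X
  have coalg: "\<alpha> (Dom B f) \<in> Hom B (Dom B f) (Fob C (Dom B f))"
    "Counit C (Dom B f) \<odot> \<alpha> (Dom B f) = Ident B (Dom B f)"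
    "Comult C (Dom B f) \<odot> \<alpha> (Dom B f) = Fmap C (\<alpha> (Dom B f)) \<odot> \<alpha> (Dom B f)"
    if "f \<in> ix X" for f X
    using \<alpha>[of "Dom B f"] that by (auto simp: is_coalgebra_def ix_iff)
  have c_in: "c f \<in> Hom B (Dom B f) (Fob C X)" if "f \<in> ix X" for f X
    unfolding c_def using coalg(1)[OF that] C_map that comp_in by (auto simp: ix_iff)
  have c_comp: "Fmap C h \<odot> c f = c (h \<odot> f)" if "f \<in> ix X" "h \<in> Hom B X Y" for f h X Y
  proof -
    have f: "f \<in> Hom B (Dom B f) X"
      using that by (simp add: ix_iff)
    show ?thesis
      unfolding c_def using assoc[OF coalg(1)[OF that(1)] C_map[OF f] C_map[OF that(2)]]
        C_map_comp[OF f that(2)] ix_comp[OF that] by simp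
  qed
  have t_in: "\<tau> X \<in> Hom B (Fob D X) (Fob C X)" if "X \<in> Ob B" for X
    unfolding \<tau>_def by (rule copair(1)[OF that C_ob[OF that] c_in])
  have t_inc: "\<tau> X \<odot> inc f = c f" if "X \<in> Ob B" "f \<in> ix X" for X f
    unfolding \<tau>_def by (rule copair(2)[OF that(1) C_ob[OF that(1)] c_in that(2)])
  have nat: "Fmap C h \<odot> \<tau> X = \<tau> Y \<odot> Fmap D h" if h: "h \<in> Hom B X Y" for h X Y
  proof (rule coproduct_ext[OF density_coproduct])
    have X: "X \<in> Ob B" and Y: "Y \<in> Ob B"
      using hom_ob[OF h] by auto
    show "X \<in> Ob B" by fact
    show "Fmap C h \<odot> \<tau> X \<in> Hom B (Fob D X) (Fob C Y)"
      by (rule comp_in[OF t_in[OF X] C_map[OF h]])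
    show "\<tau> Y \<odot> Fmap D h \<in> Hom B (Fob D X) (Fob C Y)"
      by (rule comp_in[OF D_map(1)[OF h] t_in[OF Y]])
    show "(Fmap C h \<odot> \<tau> X) \<odot> inc f = (\<tau> Y \<odot> Fmap D h) \<odot> inc f" if f: "f \<in> ix X" for f
      using assoc[OF inc_in[OF X f] t_in[OF X] C_map[OF h]] t_inc[OF X f] c_comp[OF f h]
        assoc[OF inc_in[OF X f] D_map(1)[OF h] t_in[OF Y]] D_map(2)[OF h f]
        t_inc[OF Y, of "h \<odot> f"] ix_comp[OF f h] by simp
  qed
  have counit: "Counit C X \<odot> \<tau> X = Counit D X" if X: "X \<in> Ob B" for X
  proof (rule coproduct_ext[OF density_coproduct[OF X]])
    show "Counit C X \<odot> \<tau> X \<in> Hom B (Fob D X) X"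
      by (rule comp_in[OF t_in[OF X] C_counit[OF X]])
    show "Counit D X \<in> Hom B (Fob D X) X"
      by (rule D_counit(1)[OF X])
    fix f assume f: "f \<in> ix X"
    then have fh: "f \<in> Hom B (Dom B f) X"
      by (simp add: ix_iff)
    have A: "Dom B f \<in> Ob B"
      using hom_ob[OF fh] by simp
    have "(Counit C X \<odot> \<tau> X) \<odot> inc f = Counit C X \<odot> (Fmap C f \<odot> \<alpha> (Dom B f))"
      using assoc[OF inc_in[OF X f] t_in[OF X] C_counit[OF X]] t_inc[OF X f]
      by (simp add: c_def)
    also have "\<dots> = (f \<odot> Counit C (Dom B f)) \<odot> \<alpha> (Dom B f)"
      using assoc[OF coalg(1)[OF f] C_map[OF fh] C_counit[OF X]] C_counit_natural[OF fh] by simp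
    also have "\<dots> = f"
      using assoc[OF coalg(1)[OF f] C_counit[OF A] fh] coalg(2)[OF f] ident_right[OF fh] by simp
    also have "\<dots> = Counit D X \<odot> inc f"
      using D_counit(2)[OF X f] by simp
    finally show "(Counit C X \<odot> \<tau> X) \<odot> inc f = Counit D X \<odot> inc f" .
  qed
  have comult: "Comult C X \<odot> \<tau> X = \<tau> (Fob C X) \<odot> (Fmap D (\<tau> X) \<odot> Comult D X)"
    if X: "X \<in> Ob B" for X
  proof (rule coproduct_ext[OF density_coproduct[OF X]])
    note CX = C_ob[OF X] and DX = D_ob[OF X]
    note Dt = D_map[OF t_in[OF X]]
    show "Comult C X \<odot> \<tau> X \<in> Hom B (Fob D X) (Fob C (Fob C X))"
      by (rule comp_in[OF t_in[OF X] C_comult[OF X]])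
    show "\<tau> (Fob C X) \<odot> (Fmap D (\<tau> X) \<odot> Comult D X) \<in> Hom B (Fob D X) (Fob C (Fob C X))"
      by (rule comp_in[OF comp_in[OF D_comult(1)[OF X] Dt(1)] t_in[OF CX]])
    fix f assume f: "f \<in> ix X"
    then have fh: "f \<in> Hom B (Dom B f) X"
      by (simp add: ix_iff)
    let ?A = "Dom B f"
    have A: "?A \<in> Ob B"
      using hom_ob[OF fh] by simp
    note a = coalg(1)[OF f]
    have "(Comult C X \<odot> \<tau> X) \<odot> inc f = Comult C X \<odot> (Fmap C f \<odot> \<alpha> ?A)"
      using assoc[OF inc_in[OF X f] t_in[OF X] C_comult[OF X]] t_inc[OF X f]
      by (simp add: c_def)
    also have "\<dots> = (Fmap C (Fmap C f) \<odot> Comult C ?A) \<odot> \<alpha> ?A"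
      using assoc[OF a C_map[OF fh] C_comult[OF X]] C_comult_natural[OF fh] by simp
    also have "\<dots> = Fmap C (Fmap C f) \<odot> (Fmap C (\<alpha> ?A) \<odot> \<alpha> ?A)"
      using assoc[OF a C_comult[OF A] C_map[OF C_map[OF fh]]] coalg(3)[OF f] by simp
    also have "\<dots> = Fmap C (c f) \<odot> \<alpha> ?A"
      using assoc[OF a C_map[OF a] C_map[OF C_map[OF fh]]] C_map_comp[OF a C_map[OF fh]]
      by (simp add: c_def)
    \<comment> \<open>The arrow \<open>c f\<close> equals \<open>\<tau> X \<odot> inc f\<close> and
      still starts at the representative \<open>?A\<close>. It is therefore an index over C X, and
      the expression reached is the value of \<open>c\<close> at that index.\<close>
    also have "\<dots> = c (\<tau> X \<odot> inc f)"
      using t_inc[OF X f] c_in[OF f] by (simp add: c_def Hom_def)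
    also have "\<dots> = \<tau> (Fob C X) \<odot> inc (\<tau> X \<odot> inc f)"
      using t_inc[OF CX, of "\<tau> X \<odot> inc f"] ix_comp inc_ix[OF X f] t_in[OF X] by metis
    also have "\<dots> = \<tau> (Fob C X) \<odot> (Fmap D (\<tau> X) \<odot> inc (inc f))"
      using Dt(2) inc_ix[OF X f] by simp
    also have "\<dots> = \<tau> (Fob C X) \<odot> ((Fmap D (\<tau> X) \<odot> Comult D X) \<odot> inc f)"
      using assoc[OF inc_in[OF X f] D_comult(1)[OF X] Dt(1)] D_comult(2)[OF X f] by simp
    also have "\<dots> = (\<tau> (Fob C X) \<odot> (Fmap D (\<tau> X) \<odot> Comult D X)) \<odot> inc f"
      using assoc[OF inc_in[OF X f] comp_in[OF D_comult(1)[OF X] Dt(1)] t_in[OF CX]] by simp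
    finally show "(Comult C X \<odot> \<tau> X) \<odot> inc f
      = (\<tau> (Fob C X) \<odot> (Fmap D (\<tau> X) \<odot> Comult D X)) \<odot> inc f" .
  qed
  have "Fmap C f \<odot> \<tau> (Dom B f) = \<tau> (Cod B f) \<odot> Fmap D f" if "f \<in> Arr B" for f
    using nat[of f "Dom B f" "Cod B f"] that by (simp add: Hom_def)
  then show ?thesis
    unfolding comonad_morphism_def is_natural_def
    using t_in counit comult by (intro exI[of _ \<tau>]) blast
qed

text \<open>The coproduct inclusions \<open>k i\<close> are required to be indices over X, so that
  \<open>inc (k i)\<close> exists; these arrows assemble to \<open>a\<close>. Both coalgebra laws
  for \<open>\<tau> X \<odot> a\<close> are then tested on each \<open>k i\<close>.\<close>

lemma coalgebra_from_comonad_morphism: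
  assumes \<tau>: "comonad_morphism B D C \<tau>"
    and k: "\<And>i. i \<in> I \<Longrightarrow> k i \<in> ix X"
    and X: "is_coproduct B I (\<lambda>i. Dom B (k i)) X k"
  shows "\<exists>\<alpha>. is_coalgebra B C X \<alpha>"
proof -
  have Xob: "X \<in> Ob B"
    using X by (simp add: is_coproduct_def)
  note DX = D_ob[OF Xob] and CX = C_ob[OF Xob]
  obtain a where a: "a \<in> Hom B X (Fob D X)" and ak: "\<And>i. i \<in> I \<Longrightarrow> a \<odot> k i = inc (k i)"
    using coproduct_copair[OF X DX, of "\<lambda>i. inc (k i)"] inc_in[OF Xob k] by blast
  have t_in: "\<tau> Y \<in> Hom B (Fob D Y) (Fob C Y)" if "Y \<in> Ob B" for Y
    using \<tau> that by (simp add: comonad_morphism_def is_natural_def)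
  have nat: "Fmap C h \<odot> \<tau> Y = \<tau> Z \<odot> Fmap D h" if "h \<in> Hom B Y Z" for h Y Z
    using \<tau> that by (auto simp: comonad_morphism_def is_natural_def Hom_def)
  have counit: "Counit C X \<odot> \<tau> X = Counit D X"
    and comult: "Comult C X \<odot> \<tau> X = \<tau> (Fob C X) \<odot> (Fmap D (\<tau> X) \<odot> Comult D X)"
    using \<tau> Xob by (simp_all add: comonad_morphism_def)
  note t = t_in[OF Xob] and tC = t_in[OF CX]
  define \<beta> where "\<beta> = \<tau> X \<odot> a"
  have \<beta>: "\<beta> \<in> Hom B X (Fob C X)"
    unfolding \<beta>_def by (rule comp_in[OF a t])
  have kh: "k i \<in> Hom B (Dom B (k i)) X" if "i \<in> I" for i
    using k[OF that] by (simp add: ix_iff)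
  have \<beta>k: "\<beta> \<odot> k i = \<tau> X \<odot> inc (k i)" if "i \<in> I" for i
    unfolding \<beta>_def using assoc[OF kh[OF that] a t] ak[OF that] by simp
  have 1: "Counit C X \<odot> \<beta> = Ident B X"
  proof (rule coproduct_ext[OF X])
    show "Counit C X \<odot> \<beta> \<in> Hom B X X"
      by (rule comp_in[OF \<beta> C_counit[OF Xob]])
    show "Ident B X \<in> Hom B X X"
      by (rule ident_in[OF Xob])
    fix i assume i: "i \<in> I"
    have "(Counit C X \<odot> \<beta>) \<odot> k i = Counit C X \<odot> (\<tau> X \<odot> inc (k i))"
      using assoc[OF kh[OF i] \<beta> C_counit[OF Xob]] \<beta>k[OF i] by simp
    also have "\<dots> = k i"
      using assoc[OF inc_in[OF Xob k[OF i]] t C_counit[OF Xob]] counit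
        D_counit(2)[OF Xob k[OF i]] by simp
    finally show "(Counit C X \<odot> \<beta>) \<odot> k i = Ident B X \<odot> k i"
      using ident_left[OF kh[OF i]] by simp
  qed
  have 2: "Comult C X \<odot> \<beta> = Fmap C \<beta> \<odot> \<beta>"
  proof (rule coproduct_ext[OF X])
    show "Comult C X \<odot> \<beta> \<in> Hom B X (Fob C (Fob C X))"
      by (rule comp_in[OF \<beta> C_comult[OF Xob]])
    show "Fmap C \<beta> \<odot> \<beta> \<in> Hom B X (Fob C (Fob C X))"
      by (rule comp_in[OF \<beta> C_map[OF \<beta>]])
    fix i assume i: "i \<in> I"
    note ki = k[OF i] and inci = inc_in[OF Xob k[OF i]]
    note Dt = D_map[OF t]
    have "(Comult C X \<odot> \<beta>) \<odot> k i = Comult C X \<odot> (\<tau> X \<odot> inc (k i))"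
      using assoc[OF kh[OF i] \<beta> C_comult[OF Xob]] \<beta>k[OF i] by simp
    also have "\<dots> = (\<tau> (Fob C X) \<odot> (Fmap D (\<tau> X) \<odot> Comult D X)) \<odot> inc (k i)"
      using assoc[OF inci t C_comult[OF Xob]] comult by simp
    also have "\<dots> = \<tau> (Fob C X) \<odot> ((Fmap D (\<tau> X) \<odot> Comult D X) \<odot> inc (k i))"
      by (rule assoc[OF inci comp_in[OF D_comult(1)[OF Xob] Dt(1)] tC])
    also have "(Fmap D (\<tau> X) \<odot> Comult D X) \<odot> inc (k i) = Fmap D (\<tau> X) \<odot> inc (inc (k i))"
      using assoc[OF inci D_comult(1)[OF Xob] Dt(1)] D_comult(2)[OF Xob ki] by simp
    \<comment> \<open>D applied to \<open>\<tau> X\<close> acts on inclusions by composing their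
      index, and the resulting index is \<open>\<beta> \<odot> k i\<close>. Reading it next as D
      applied to \<open>\<beta>\<close> makes naturality of \<open>\<tau>\<close> at
      \<open>\<beta>\<close> applicable.\<close>
    also have "\<dots> = inc (\<beta> \<odot> k i)"
      using Dt(2) inc_ix[OF Xob ki] \<beta>k[OF i] by simp
    also have "\<dots> = Fmap D \<beta> \<odot> inc (k i)"
      using D_map(2)[OF \<beta> ki] by simp
    also have "\<tau> (Fob C X) \<odot> (Fmap D \<beta> \<odot> inc (k i)) = (Fmap C \<beta> \<odot> \<tau> X) \<odot> inc (k i)"
      using assoc[OF inci D_map(1)[OF \<beta>] tC] nat[OF \<beta>] by simp
    also have "\<dots> = Fmap C \<beta> \<odot> (\<beta> \<odot> k i)"
      using assoc[OF inci t C_map[OF \<beta>]] \<beta>k[OF i] by simp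
    also have "\<dots> = (Fmap C \<beta> \<odot> \<beta>) \<odot> k i"
      using assoc[OF kh[OF i] \<beta> C_map[OF \<beta>]] by simp
    finally show "(Comult C X \<odot> \<beta>) \<odot> k i = (Fmap C \<beta> \<odot> \<beta>) \<odot> k i" .
  qed
  show ?thesis
    using \<beta> 1 2 by (auto simp: is_coalgebra_def)
qed

end

end

section \<open>Small sets\<close>

locale small_sets =
  fixes small :: "'u set \<Rightarrow> bool"
  assumes universe: "universe small"
begin

text \<open>\<open>small\<close> applies only to subsets of the type \<open>'u\<close>, whereas the
  sets to be bounded consist of objects, arrows or pairs. \<open>tiny\<close> transfers the notion
  to any type and agrees with \<open>small\<close> on \<open>'u\<close>.\<close>

definition tiny :: "'a set \<Rightarrow> bool" where
  "tiny S \<longleftrightarrow> (\<exists>K. small K \<and> S \<lesssim> K)"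

lemma small_lepoll: "small X \<Longrightarrow> Y \<lesssim> X \<Longrightarrow> small Y"
  using universe unfolding universe_def by blast

lemma small_subset: "small X \<Longrightarrow> Y \<subseteq> X \<Longrightarrow> small Y"
  using small_lepoll subset_imp_lepoll by blast

lemma ex_infinite_small: "\<exists>X. small X \<and> infinite X"
  using universe by (simp add: universe_def)

lemma small_UN: "small I \<Longrightarrow> (\<And>i. i \<in> I \<Longrightarrow> small (F i)) \<Longrightarrow> small (\<Union>i\<in>I. F i)"
  using universe by (simp add: universe_def)

lemma tiny_lepoll: "tiny T \<Longrightarrow> S \<lesssim> T \<Longrightarrow> tiny S"
  unfolding tiny_def using lepoll_trans by blast

lemma tiny_subset: "tiny T \<Longrightarrow> S \<subseteq> T \<Longrightarrow> tiny S"
  using tiny_lepoll subset_imp_lepoll by blast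

lemma tiny_image: "tiny S \<Longrightarrow> tiny (f ` S)"
  using tiny_lepoll image_lepoll by blast

lemma tiny_inj: "inj_on f S \<Longrightarrow> tiny (f ` S) \<Longrightarrow> tiny S"
  using tiny_lepoll[of "f ` S" S] by (auto simp: lepoll_def)

lemma tiny_iff_small: "tiny S \<longleftrightarrow> small S"
  unfolding tiny_def using small_lepoll lepoll_refl by blast

lemma tiny_countable:
  assumes "countable S"
  shows "tiny S"
proof -
  obtain N where N: "small N" "infinite N"
    using ex_infinite_small by blast
  have "S \<lesssim> (UNIV :: nat set)"
    using assms unfolding countable_def lepoll_def by blast
  also have "\<dots> \<lesssim> N"
    using N(2) infinite_le_lepoll by blast
  finally show ?thesis
    using N(1) tiny_def by blast
qed

text \<open>The universe provides unions over small index sets only; two distinct elements of an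
  infinite small set serve as the indices for a binary union.\<close>

lemma small_Un:
  assumes "small X" "small Y"
  shows "small (X \<union> Y)"
proof -
  obtain N where N: "small N" "infinite N"
    using ex_infinite_small by blast
  obtain a where a: "a \<in> N"
    using N(2) by fastforce
  have "infinite (N - {a})"
    using N(2) by simp
  then obtain b where b: "b \<in> N" "b \<noteq> a"
    by (metis Diff_iff ex_in_conv infinite_imp_nonempty insertI1)
  have "small (\<Union>i\<in>{a, b}. if i = a then X else Y)"
    by (rule small_UN) (use small_subset[OF N(1)] a b assms in auto)
  then show ?thesis
    using b by (simp add: Un_commute)
qed

text \<open>Both bounds are enlarged to one infinite small set \<open>M\<close>, which is
  equipollent to its own square.\<close>

lemma tiny_times:
  assumes "tiny S" "tiny T"
  shows "tiny (S \<times> T)"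
proof -
  obtain K L N where K: "small K" "S \<lesssim> K" and L: "small L" "T \<lesssim> L" and N: "small N" "infinite N"
    using assms ex_infinite_small unfolding tiny_def by blast
  define M where "M = K \<union> L \<union> N"
  have M: "small M" "infinite M" "K \<subseteq> M" "L \<subseteq> M"
    using K L N small_Un by (auto simp: M_def)
  have "S \<times> T \<lesssim> M \<times> M"
    using K(2) L(2) M(3,4) by (intro times_lepoll_mono) (meson lepoll_trans subset_imp_lepoll)+
  also have "M \<times> M \<approx> M"
    using card_of_Times_same_infinite[OF M(2)] eqpoll_iff_card_of_ordIso by blast
  finally show ?thesis
    using M(1) tiny_def by blast
qed

lemma small_UN_tiny:
  assumes "tiny I" "\<And>i. i \<in> I \<Longrightarrow> small (F i)"
  shows "small (\<Union>i\<in>I. F i)"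
proof -
  obtain K e where K: "small K" "inj_on e I" "e ` I \<subseteq> K"
    using assms(1) unfolding tiny_def lepoll_def by blast
  have "small (\<Union>k\<in>e ` I. F (inv_into I e k))"
    by (rule small_UN) (use small_subset[OF K(1,3)] assms(2) K(2) in auto)
  then show ?thesis
    using K(2) by simp
qed

text \<open>The fibres come with different bounding sets \<open>K i\<close>. Their union is again
  small, so the sum embeds in a product with a common second factor.\<close>

lemma tiny_Sigma:
  assumes "tiny I" "\<And>i. i \<in> I \<Longrightarrow> tiny (F i)"
  shows "tiny (Sigma I F)"
proof -
  have "\<forall>i\<in>I. \<exists>K e. small K \<and> inj_on e (F i) \<and> e ` F i \<subseteq> K"
    using assms(2) unfolding tiny_def lepoll_def by blast
  then obtain K e where Ke: "\<And>i. i \<in> I \<Longrightarrow> small (K i) \<and> inj_on (e i) (F i) \<and> e i ` F i \<subseteq> K i"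
    by metis
  have "small (\<Union>i\<in>I. K i)"
    using small_UN_tiny[OF assms(1)] Ke by blast
  then have "tiny (I \<times> (\<Union>i\<in>I. K i))"
    using tiny_times[OF assms(1)] tiny_iff_small by blast
  moreover have "Sigma I F \<lesssim> I \<times> (\<Union>i\<in>I. K i)"
    unfolding lepoll_def
  proof (intro exI conjI)
    show "inj_on (\<lambda>(i, x). (i, e i x)) (Sigma I F)"
      using Ke by (auto simp: inj_on_def)
    show "(\<lambda>(i, x). (i, e i x)) ` Sigma I F \<subseteq> I \<times> (\<Union>i\<in>I. K i)"
      using Ke by fastforce
  qed
  ultimately show ?thesis
    using tiny_lepoll by blast
qed

lemma tiny_UN:
  assumes "tiny I" "\<And>i. i \<in> I \<Longrightarrow> tiny (F i)"
  shows "tiny (\<Union>i\<in>I. F i)"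
proof -
  have "(\<Union>i\<in>I. F i) = snd ` Sigma I F"
    by force
  then show ?thesis
    using tiny_image[OF tiny_Sigma[OF assms]] by simp
qed

text \<open>With a finite domain a function set is an iterated product, so products suffice and no
  power set is formed.\<close>

lemma tiny_PiE:
  assumes "finite S" "tiny T"
  shows "tiny (S \<rightarrow>\<^sub>E T)"
  using assms(1)
proof (induction S)
  case empty
  show ?case
    by (rule tiny_countable) simp
next
  case (insert x S)
  show ?case
    unfolding PiE_insert_eq using tiny_image[OF tiny_times[OF assms(2) insert.IH]] by simp
qed

end

section \<open>Relational categories\<close>

text \<open>The direct image of a set of labelled tuples. It turns preservation of all relations
  into one inclusion, and it also describes the tuples of a disjoint union.\<close>

definition push :: "('a \<Rightarrow> 'b) \<Rightarrow> ('r \<times> 'a list) set \<Rightarrow> ('r \<times> 'b list) set" where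
  "push f E = (\<lambda>(R, xs). (R, map f xs)) ` E"

lemma push_push: "push g (push f E) = push (\<lambda>x. g (f x)) E"
  by (force simp: push_def)

lemma push_mono: "E \<subseteq> E' \<Longrightarrow> push f E \<subseteq> push f E'"
  by (auto simp: push_def)

lemma push_UN: "push f (\<Union>i\<in>I. E i) = (\<Union>i\<in>I. push f (E i))"
  by (auto simp: push_def)

lemma push_ident: "push (\<lambda>x. x) E = E"
  by (simp add: push_def)

lemma push_memI: "(R, xs) \<in> E \<Longrightarrow> (R, map f xs) \<in> push f E"
  by (force simp: push_def)

lemma push_memE:
  assumes "(R, ys) \<in> push f E"
  obtains xs where "(R, xs) \<in> E" "ys = map f xs"
  using assms by (auto simp: push_def)

text \<open>A common generalisation of structures and graphs: an object is given by its underlying set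
  and its labelled tuples (a graph has one label and the tuples \<open>[x, y]\<close> with \<open>(x, y)\<close> an edge).
  \<open>glue\<close> yields coproducts and isomorphic copies, \<open>induced\<close> the components, and \<open>few\<close> makes the
  coproduct defining the density comonad a small one.\<close>

locale relational = small_sets small
  for small :: "'u set \<Rightarrow> bool" +
  fixes obs :: "'o set" and und :: "'o \<Rightarrow> 'u set" and rels :: "'o \<Rightarrow> ('r \<times> 'u list) set"
    and preserves :: "'o \<Rightarrow> 'o \<Rightarrow> ('u \<Rightarrow> 'u) \<Rightarrow> bool"
  assumes small_und: "X \<in> obs \<Longrightarrow> small (und X)"
    and tuple: "X \<in> obs \<Longrightarrow> (R, xs) \<in> rels X \<Longrightarrow> xs \<noteq> [] \<and> set xs \<subseteq> und X"
    and preserves_iff: "X \<in> obs \<Longrightarrow> Y \<in> obs \<Longrightarrow> preserves X Y f \<longleftrightarrow> push f (rels X) \<subseteq> rels Y"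
    and glue: "small U \<Longrightarrow>
      (\<And>i. i \<in> (I :: 'u set) \<Longrightarrow> F i \<in> obs \<and> inj_on (j i) (und (F i)) \<and> j i ` und (F i) \<subseteq> U) \<Longrightarrow>
      \<exists>P\<in>obs. und P = U \<and> rels P = (\<Union>i\<in>I. push (j i) (rels (F i :: 'o)))"
    and induced: "X \<in> obs \<Longrightarrow> S \<subseteq> und X \<Longrightarrow>
      \<exists>Y\<in>obs. und Y = S \<and> rels Y = {(R, xs) \<in> rels X. set xs \<subseteq> S}"
    and few: "countable N \<Longrightarrow> tiny {X \<in> obs. finite (und X) \<and> und X \<subseteq> N}"
begin

abbreviation "B \<equiv> concrete_category obs und preserves"

text \<open>All entries of tuples lie in the underlying set, so it does not matter that the
  functions of arrows are cut down to it by \<open>restrict\<close>.\<close>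

lemma push_cong:
  assumes "X \<in> obs" "\<And>x. x \<in> und X \<Longrightarrow> f x = g x"
  shows "push f (rels X) = push g (rels X)"
proof -
  have "map f xs = map g xs" if "(R, xs) \<in> rels X" for R xs
    using tuple[OF assms(1) that] assms(2) by auto
  then show ?thesis
    unfolding push_def by (intro image_cong) auto
qed

lemma Ob_B [simp]: "Ob B = obs"
  and Dom_B [simp]: "Dom B = src"
  and Cod_B [simp]: "Cod B = tgt"
  and Und_B [simp]: "Und B = und"
  by (simp_all add: concrete_category_def)

lemma src_Comp [simp]: "src (Comp B g f) = src f"
  and tgt_Comp [simp]: "tgt (Comp B g f) = tgt g"
  and fn_Comp: "fn (Comp B g f) = compose (und (src f)) (fn g) (fn f)"
  by (simp_all add: concrete_category_def)

lemma fn_Ident: "fn (Ident B X) = restrict id (und X)"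
  by (simp add: concrete_category_def)

lemma Hom_iff:
  "f \<in> Hom B X Y \<longleftrightarrow> X \<in> obs \<and> Y \<in> obs \<and> src f = X \<and> tgt f = Y \<and>
    fn f \<in> und X \<rightarrow>\<^sub>E und Y \<and> push (fn f) (rels X) \<subseteq> rels Y"
  by (auto simp: Hom_def concrete_category_def preserves_iff)

lemma HomD:
  assumes "f \<in> Hom B X Y"
  shows "X \<in> obs" "Y \<in> obs" "src f = X" "tgt f = Y" "fn f \<in> und X \<rightarrow>\<^sub>E und Y"
    "push (fn f) (rels X) \<subseteq> rels Y"
  using assms by (simp_all add: Hom_iff)

lemma Hom_app: "f \<in> Hom B X Y \<Longrightarrow> x \<in> und X \<Longrightarrow> fn f x \<in> und Y"
  by (auto simp: Hom_iff)

lemma Comp_app: "f \<in> Hom B X Y \<Longrightarrow> x \<in> und X \<Longrightarrow> fn (Comp B g f) x = fn g (fn f x)"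
  by (simp add: Hom_iff fn_Comp compose_eq)

lemma Hom_eqI:
  assumes f: "f \<in> Hom B X Y" and g: "g \<in> Hom B X Y" and eq: "\<And>x. x \<in> und X \<Longrightarrow> fn f x = fn g x"
  shows "f = g"
proof -
  have "fn f = fn g"
    using PiE_ext[OF HomD(5)[OF f] HomD(5)[OF g] eq] .
  then show ?thesis
    using HomD(3,4)[OF f] HomD(3,4)[OF g] by (cases f, cases g) simp
qed

lemma restrict_Hom:
  assumes "X \<in> obs" "Y \<in> obs" "f \<in> und X \<rightarrow> und Y" "push f (rels X) \<subseteq> rels Y"
  shows "\<lparr>src = X, tgt = Y, fn = restrict f (und X)\<rparr> \<in> Hom B X Y"
  using assms push_cong[OF assms(1), of "restrict f (und X)" f] by (simp add: Hom_iff)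

lemma Comp_Hom:
  assumes f: "f \<in> Hom B X Y" and g: "g \<in> Hom B Y Z"
  shows "Comp B g f \<in> Hom B X Z"
proof -
  have "push (fn (Comp B g f)) (rels X) = push (fn g) (push (fn f) (rels X))"
    unfolding push_push by (rule push_cong[OF HomD(1)[OF f] Comp_app[OF f]])
  also have "\<dots> \<subseteq> rels Z"
    using push_mono[OF HomD(6)[OF f]] HomD(6)[OF g] by blast
  finally show ?thesis
    using HomD[OF f] HomD[OF g] by (auto simp: Hom_iff fn_Comp compose_def)
qed

lemma Ident_Hom: "X \<in> obs \<Longrightarrow> Ident B X \<in> Hom B X X"
  using restrict_Hom[of X X id] by (simp add: concrete_category_def push_ident id_def)

sublocale cat B
proof
  fix f W X Y Z g h
  show "f \<in> Arr B \<Longrightarrow> Dom B f \<in> Ob B \<and> Cod B f \<in> Ob B"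
    by (simp add: concrete_category_def)
  show "X \<in> Ob B \<Longrightarrow> Ident B X \<in> Hom B X X"
    using Ident_Hom by simp
  show "f \<in> Hom B X Y \<Longrightarrow> g \<in> Hom B Y Z \<Longrightarrow> Comp B g f \<in> Hom B X Z"
    by (rule Comp_Hom)
  show "Comp B (Comp B h g) f = Comp B h (Comp B g f)"
    if f: "f \<in> Hom B W X" and g: "g \<in> Hom B X Y" and h: "h \<in> Hom B Y Z"
  proof (rule Hom_eqI)
    show "Comp B (Comp B h g) f \<in> Hom B W Z" "Comp B h (Comp B g f) \<in> Hom B W Z"
      using f g h Comp_Hom by blast+
    show "fn (Comp B (Comp B h g) f) x = fn (Comp B h (Comp B g f)) x" if "x \<in> und W" for x
      using Comp_app[OF f that] Comp_app[OF g Hom_app[OF f that]]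
        Comp_app[OF Comp_Hom[OF f g] that] by simp
  qed
  show "Comp B (Ident B Y) f = f" if f: "f \<in> Hom B X Y"
    using Comp_app[OF f] Hom_app[OF f] HomD(2)[OF f]
    by (intro Hom_eqI[OF Comp_Hom[OF f Ident_Hom] f]) (auto simp: fn_Ident)
  show "Comp B f (Ident B X) = f" if f: "f \<in> Hom B X Y"
    using Comp_app[OF Ident_Hom] HomD(1)[OF f]
    by (intro Hom_eqI[OF Comp_Hom[OF Ident_Hom f] f]) (auto simp: fn_Ident)
qed

section \<open>Concrete disjoint unions as coproducts\<close>

definition disjoint_union ::
  "'i set \<Rightarrow> ('i \<Rightarrow> 'o) \<Rightarrow> 'o \<Rightarrow> ('i \<Rightarrow> ('o, 'u) arrow) \<Rightarrow> bool" where
  "disjoint_union I F P \<iota> \<longleftrightarrow>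
     P \<in> obs \<and> (\<forall>i\<in>I. \<iota> i \<in> Hom B (F i) P \<and> inj_on (fn (\<iota> i)) (und (F i))) \<and>
     (\<forall>i\<in>I. \<forall>j\<in>I. \<forall>x\<in>und (F i). \<forall>y\<in>und (F j). fn (\<iota> i) x = fn (\<iota> j) y \<longrightarrow> i = j) \<and>
     und P = (\<Union>i\<in>I. fn (\<iota> i) ` und (F i)) \<and>
     rels P = (\<Union>i\<in>I. push (fn (\<iota> i)) (rels (F i)))"

lemma disjoint_union_coproduct:
  assumes P: "disjoint_union I F P \<iota>"
  shows "is_coproduct B I F P \<iota>"
proof -
  have Pob: "P \<in> obs" and \<iota>: "\<And>i. i \<in> I \<Longrightarrow> \<iota> i \<in> Hom B (F i) P"
    and uP: "und P = (\<Union>i\<in>I. fn (\<iota> i) ` und (F i))"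
    and rP: "rels P = (\<Union>i\<in>I. push (fn (\<iota> i)) (rels (F i)))"
    using P by (simp_all add: disjoint_union_def)
  have "\<exists>!u. u \<in> Hom B P Q \<and> (\<forall>i\<in>I. Comp B u (\<iota> i) = g i)"
    if Q: "Q \<in> obs" and g: "\<And>i. i \<in> I \<Longrightarrow> g i \<in> Hom B (F i) Q" for Q g
  proof -
    \<comment> \<open>Each y in P has exactly one origin: disjointness of the images determines i
      and injectivity determines x. Hence the choice is a genuine definition by cases on the
      summands.\<close>
    define w where "w y = (SOME z. \<exists>i\<in>I. \<exists>x\<in>und (F i). y = fn (\<iota> i) x \<and> z = fn (g i) x)" for y
    have w: "w (fn (\<iota> i) x) = fn (g i) x" if i: "i \<in> I" and x: "x \<in> und (F i)" for i x
      unfolding w_def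
    proof (rule some_equality)
      show "\<exists>i'\<in>I. \<exists>x'\<in>und (F i'). fn (\<iota> i) x = fn (\<iota> i') x' \<and> fn (g i) x = fn (g i') x'"
        using i x by blast
      show "z = fn (g i) x"
        if "\<exists>i'\<in>I. \<exists>x'\<in>und (F i'). fn (\<iota> i) x = fn (\<iota> i') x' \<and> z = fn (g i') x'" for z
        using that i x P unfolding disjoint_union_def inj_on_def by metis
    qed
    define u where "u = \<lparr>src = P, tgt = Q, fn = restrict w (und P)\<rparr>"
    have "push w (rels P) = (\<Union>i\<in>I. push (fn (g i)) (rels (F i)))"
      unfolding rP push_UN push_push
      by (intro SUP_cong refl push_cong HomD(1)[OF \<iota>] w)
    then have "push w (rels P) \<subseteq> rels Q"
      using HomD(6)[OF g] by blast
    moreover have "w \<in> und P \<rightarrow> und Q"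
      using w Hom_app[OF g] by (auto simp: uP)
    ultimately have u: "u \<in> Hom B P Q"
      unfolding u_def by (intro restrict_Hom Pob Q)
    have fu: "fn u (fn (\<iota> i) x) = fn (g i) x" if "i \<in> I" "x \<in> und (F i)" for i x
      using w[OF that] that Hom_app[OF \<iota> that(2)] by (simp add: u_def)
    have comp_iff: "(\<forall>i\<in>I. Comp B v (\<iota> i) = g i) \<longleftrightarrow> (\<forall>i\<in>I. \<forall>x\<in>und (F i). fn v (fn (\<iota> i) x) = fn (g i) x)"
      if "v \<in> Hom B P Q" for v
      using that Comp_app[OF \<iota>] Hom_eqI[OF Comp_Hom[OF \<iota> that] g] by metis
    show ?thesis
    proof (rule ex1I[of _ u])
      show "u \<in> Hom B P Q \<and> (\<forall>i\<in>I. Comp B u (\<iota> i) = g i)"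
        using u fu comp_iff by blast
      fix v assume v: "v \<in> Hom B P Q \<and> (\<forall>i\<in>I. Comp B v (\<iota> i) = g i)"
      then show "v = u"
        using comp_iff fu u by (intro Hom_eqI[of v P Q u]) (auto simp: uP)
    qed
  qed
  then show ?thesis
    using Pob \<iota> HomD(1)[OF \<iota>] by (simp add: is_coproduct_def)
qed

text \<open>The injection \<open>e\<close> of the tagged sum into a small set names the elements of
  the union. As \<open>glue\<close> accepts only indices from \<open>'u\<close>, a second injection
  \<open>c\<close> encodes the index set, and \<open>?n\<close> decodes it.\<close>

lemma ex_disjoint_union:
  assumes I: "tiny I" and F: "\<And>i. i \<in> I \<Longrightarrow> F i \<in> obs"
  shows "\<exists>P \<iota>. disjoint_union I F P \<iota>"
proof -
  have "tiny (Sigma I (\<lambda>i. und (F i)))"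
    by (rule tiny_Sigma[OF I]) (simp add: tiny_iff_small small_und F)
  then obtain K e where K: "small K" and e: "inj_on e (Sigma I (\<lambda>i. und (F i)))"
    and eK: "e ` Sigma I (\<lambda>i. und (F i)) \<subseteq> K"
    unfolding tiny_def lepoll_def by blast
  define U where "U = e ` Sigma I (\<lambda>i. und (F i))"
  have inj: "inj_on (\<lambda>x. e (i, x)) (und (F i))" if "i \<in> I" for i
    using e that by (auto simp: inj_on_def)
  obtain c :: "_ \<Rightarrow> 'u" where c: "inj_on c I"
    using I unfolding tiny_def lepoll_def by blast
  let ?n = "inv_into I c"
  have "\<exists>P\<in>obs. und P = U \<and>
      rels P = (\<Union>k\<in>c ` I. push (\<lambda>x. e (?n k, x)) (rels (F (?n k))))"
  proof (rule glue)
    show "small U"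
      unfolding U_def by (rule small_subset[OF K eK])
    show "F (?n k) \<in> obs \<and> inj_on (\<lambda>x. e (?n k, x)) (und (F (?n k))) \<and>
        (\<lambda>x. e (?n k, x)) ` und (F (?n k)) \<subseteq> U" if "k \<in> c ` I" for k
      using F inj inv_into_into[OF that] by (auto simp: U_def)
  qed
  then obtain P where P: "P \<in> obs" "und P = U"
    "rels P = (\<Union>i\<in>I. push (\<lambda>x. e (i, x)) (rels (F i)))"
    using c by auto
  define \<iota> where "\<iota> i = \<lparr>src = F i, tgt = P, fn = restrict (\<lambda>x. e (i, x)) (und (F i))\<rparr>" for i
  have "\<iota> i \<in> Hom B (F i) P" if "i \<in> I" for i
    unfolding \<iota>_def using that by (intro restrict_Hom F P(1)) (auto simp: P U_def)
  moreover have "push (fn (\<iota> i)) (rels (F i)) = push (\<lambda>x. e (i, x)) (rels (F i))" if "i \<in> I" for i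
    by (rule push_cong[OF F[OF that]]) (simp add: \<iota>_def)
  ultimately have "disjoint_union I F P \<iota>"
    unfolding disjoint_union_def using P e by (auto simp: \<iota>_def inj_on_def U_def image_iff)
  then show ?thesis
    by blast
qed

text \<open>The separated sets are the unions of connected components.\<close>

definition separated :: "'o \<Rightarrow> 'u set \<Rightarrow> bool" where
  "separated X S \<longleftrightarrow> S \<subseteq> und X \<and> (\<forall>(R, xs)\<in>rels X. set xs \<subseteq> S \<or> set xs \<inter> S = {})"

lemma separated_Diff: "X \<in> obs \<Longrightarrow> separated X S \<Longrightarrow> separated X T \<Longrightarrow> separated X (S - T)"
  unfolding separated_def by fast

lemma separated_Inter:
  assumes "\<And>S. S \<in> \<S> \<Longrightarrow> separated X S" "\<S> \<noteq> {}"
  shows "separated X (\<Inter>\<S>)"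
  unfolding separated_def
proof (intro conjI ballI)
  show "\<Inter>\<S> \<subseteq> und X"
    using assms unfolding separated_def by blast
  show "case p of (R, xs) \<Rightarrow> set xs \<subseteq> \<Inter>\<S> \<or> set xs \<inter> \<Inter>\<S> = {}" if "p \<in> rels X" for p
    using assms that unfolding separated_def by (cases p) blast
qed

lemma separated_und: "X \<in> obs \<Longrightarrow> separated X (und X)"
  using tuple by (auto simp: separated_def)

text \<open>The given coproduct P is compared with a concrete disjoint union \<open>P0\<close>. The
  preimage in X of one summand of \<open>P0\<close> is separated, so by indecomposability all of X
  lands in a single summand, through which the map then factors.\<close>

lemma connected_if_indecomposable:
  assumes X: "X \<in> obs" and ne: "und X \<noteq> {}"
    and indec: "\<And>S. separated X S \<Longrightarrow> S = {} \<or> S = und X"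
  shows "connected_ob small B X"
  unfolding connected_ob_def
proof (intro conjI allI impI)
  show "X \<in> Ob B"
    using X by simp
  fix I :: "'u set" and F P \<iota> f
  assume "small I \<and> is_coproduct B I F P \<iota> \<and> f \<in> Hom B X P"
  then have I: "small I" and P: "is_coproduct B I F P \<iota>" and f: "f \<in> Hom B X P"
    by auto
  have Pob: "P \<in> Ob B" and F: "\<And>i. i \<in> I \<Longrightarrow> F i \<in> obs" and \<iota>: "\<And>i. i \<in> I \<Longrightarrow> \<iota> i \<in> Hom B (F i) P"
    using P by (auto simp: is_coproduct_def)
  obtain P0 \<kappa> where P0: "disjoint_union I F P0 \<kappa>"
    using ex_disjoint_union[of I F] I F tiny_iff_small by blast
  have \<kappa>: "\<And>i. i \<in> I \<Longrightarrow> \<kappa> i \<in> Hom B (F i) P0" and P0ob: "P0 \<in> Ob B"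
    and inj: "\<And>i. i \<in> I \<Longrightarrow> inj_on (fn (\<kappa> i)) (und (F i))"
    and disj: "\<And>i j x y. i \<in> I \<Longrightarrow> j \<in> I \<Longrightarrow> x \<in> und (F i) \<Longrightarrow> y \<in> und (F j) \<Longrightarrow>
      fn (\<kappa> i) x = fn (\<kappa> j) y \<Longrightarrow> i = j"
    and uP0: "und P0 = (\<Union>i\<in>I. fn (\<kappa> i) ` und (F i))"
    and rP0: "rels P0 = (\<Union>i\<in>I. push (fn (\<kappa> i)) (rels (F i)))"
    using P0 unfolding disjoint_union_def Ob_B by (simp_all, metis)
  have same: "i = j" if ij: "i \<in> I" "j \<in> I" and z: "z \<in> fn (\<kappa> i) ` und (F i)" "z \<in> fn (\<kappa> j) ` und (F j)"
    for i j z
  proof -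
    obtain x y where "x \<in> und (F i)" "z = fn (\<kappa> i) x" "y \<in> und (F j)" "z = fn (\<kappa> j) y"
      using z by blast
    then show ?thesis
      using disj[OF ij] by simp
  qed
  obtain u where u: "u \<in> Hom B P P0" and u\<iota>: "\<And>i. i \<in> I \<Longrightarrow> Comp B u (\<iota> i) = \<kappa> i"
    using coproduct_copair[OF P P0ob \<kappa>] by blast
  obtain v where v: "v \<in> Hom B P0 P" and v\<kappa>: "\<And>i. i \<in> I \<Longrightarrow> Comp B v (\<kappa> i) = \<iota> i"
    using coproduct_copair[OF disjoint_union_coproduct[OF P0] Pob \<iota>] by blast
  \<comment> \<open>This one composite suffices: a factorisation of \<open>Comp B u f\<close>
    through \<open>\<kappa> i\<close> is sent by \<open>v\<close> to a factorisation of
    \<open>f\<close> through \<open>\<iota> i\<close>.\<close>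
  have vu: "Comp B v u = Ident B P"
    using assoc[OF \<iota> u v] u\<iota> v\<kappa> ident_left[OF \<iota>]
    by (intro coproduct_ext[OF P comp_in[OF u v] ident_in[OF Pob]]) simp
  define h where "h = Comp B u f"
  have h: "h \<in> Hom B X P0"
    unfolding h_def by (rule comp_in[OF f u])
  have vh: "Comp B v h = f"
    unfolding h_def using assoc[OF f u v] vu ident_left[OF f] by simp
  have tuples: "\<exists>k\<in>I. \<exists>ys. (R, ys) \<in> rels (F k) \<and> map (fn h) xs = map (fn (\<kappa> k)) ys"
    if "(R, xs) \<in> rels X" for R xs
  proof -
    have "(R, map (fn h) xs) \<in> rels P0"
      using HomD(6)[OF h] push_memI[OF that] by blast
    then obtain k where "k \<in> I" "(R, map (fn h) xs) \<in> push (fn (\<kappa> k)) (rels (F k))"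
      unfolding rP0 by blast
    then show ?thesis
      by (metis push_memE)
  qed
  obtain x where x: "x \<in> und X"
    using ne by blast
  obtain i where i: "i \<in> I" and xi: "fn h x \<in> fn (\<kappa> i) ` und (F i)"
    using Hom_app[OF h x] uP0 by blast
  define S where "S = {y \<in> und X. fn h y \<in> fn (\<kappa> i) ` und (F i)}"
  have "separated X S"
    unfolding separated_def
  proof (intro conjI ballI)
    show "S \<subseteq> und X"
      by (auto simp: S_def)
    \<comment> \<open>The image of a tuple comes from one tuple of one summand \<open>F k\<close>. A
      single entry lying over summand \<open>i\<close> forces \<open>k = i\<close>, and then every
      entry lies over \<open>i\<close>.\<close>
    have "set xs \<subseteq> S" if t: "(R, xs) \<in> rels X" and y: "y \<in> set xs" "y \<in> S" for R xs y
    proof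
      fix z assume z: "z \<in> set xs"
      obtain k ys where k: "k \<in> I" "(R, ys) \<in> rels (F k)" and eq: "map (fn h) xs = map (fn (\<kappa> k)) ys"
        using tuples[OF t] by blast
      have im: "fn h a \<in> fn (\<kappa> k) ` und (F k)" if "a \<in> set xs" for a
      proof -
        have "fn h a \<in> set (map (fn (\<kappa> k)) ys)"
          using that eq by (metis image_eqI list.set_map)
        then show ?thesis
          using tuple[OF F[OF k(1)] k(2)] by auto
      qed
      have "k = i"
        using same[OF k(1) i im[OF y(1)]] y(2) by (simp add: S_def)
      then show "z \<in> S"
        using im[OF z] z tuple[OF X t] by (auto simp: S_def)
    qed
    then show "case p of (R, xs) \<Rightarrow> set xs \<subseteq> S \<or> set xs \<inter> S = {}" if "p \<in> rels X" for p
      using that by (cases p) blast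
  qed
  moreover have "x \<in> S"
    using x xi by (simp add: S_def)
  ultimately have S: "S = und X"
    using indec by blast
  define g where "g = \<lparr>src = X, tgt = F i,
    fn = restrict (\<lambda>y. inv_into (und (F i)) (fn (\<kappa> i)) (fn h y)) (und X)\<rparr>"
  have \<kappa>g: "fn (\<kappa> i) (inv_into (und (F i)) (fn (\<kappa> i)) (fn h y)) = fn h y" if "y \<in> und X" for y
    using that S by (intro f_inv_into_f) (auto simp: S_def)
  have g: "g \<in> Hom B X (F i)"
    unfolding g_def
  proof (rule restrict_Hom[OF X F[OF i]])
    show "(\<lambda>y. inv_into (und (F i)) (fn (\<kappa> i)) (fn h y)) \<in> und X \<rightarrow> und (F i)"
      using S by (auto simp: S_def intro!: inv_into_into)
    show "push (\<lambda>y. inv_into (und (F i)) (fn (\<kappa> i)) (fn h y)) (rels X) \<subseteq> rels (F i)"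
    proof safe
      fix R zs assume "(R, zs) \<in> push (\<lambda>y. inv_into (und (F i)) (fn (\<kappa> i)) (fn h y)) (rels X)"
      then obtain xs where t: "(R, xs) \<in> rels X"
        and zs: "zs = map (\<lambda>y. inv_into (und (F i)) (fn (\<kappa> i)) (fn h y)) xs"
        by (rule push_memE)
      obtain k ys where k: "k \<in> I" "(R, ys) \<in> rels (F k)"
        and eq: "map (fn h) xs = map (fn (\<kappa> k)) ys"
        using tuples[OF t] by blast
      have ys: "ys \<noteq> []" "set ys \<subseteq> und (F k)"
        using tuple[OF F[OF k(1)] k(2)] by auto
      have xs: "xs \<noteq> []" "set xs \<subseteq> und X"
        using tuple[OF X t] by auto
      \<comment> \<open>Tuples are nonempty, so there is a first entry, and its image identifies the
        summand \<open>k\<close> as \<open>i\<close>.\<close>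
      have hd: "hd xs \<in> S" "hd ys \<in> und (F k)"
        using xs ys S by auto
      have "fn h (hd xs) = fn (\<kappa> k) (hd ys)"
        using eq xs(1) ys(1) by (metis hd_map)
      then have "k = i"
        using same[OF k(1) i, of "fn h (hd xs)"] hd by (simp add: S_def)
      have "zs = map (inv_into (und (F i)) (fn (\<kappa> i))) (map (fn h) xs)"
        by (simp add: zs)
      also have "\<dots> = ys"
        unfolding eq using ys(2) inj[OF i] \<open>k = i\<close> by (auto simp: map_idI subset_iff)
      finally show "(R, zs) \<in> rels (F i)"
        using k \<open>k = i\<close> by simp
    qed
  qed
  have "Comp B (\<kappa> i) g = h"
    using \<kappa>g Comp_app[OF g] by (intro Hom_eqI[OF Comp_Hom[OF g \<kappa>[OF i]] h]) (simp add: g_def)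
  then have fac: "Comp B (\<iota> i) g = f"
    using assoc[OF g \<kappa>[OF i] v] v\<kappa>[OF i] vh by simp
  show "\<exists>!(i, g). i \<in> I \<and> g \<in> Hom B X (F i) \<and> Comp B (\<iota> i) g = f"
  proof (rule ex1I[of _ "(i, g)"])
    show "case (i, g) of (i, g) \<Rightarrow> i \<in> I \<and> g \<in> Hom B X (F i) \<and> Comp B (\<iota> i) g = f"
      using i g fac by simp
    fix p assume "case p of (i, g) \<Rightarrow> i \<in> I \<and> g \<in> Hom B X (F i) \<and> Comp B (\<iota> i) g = f"
    then obtain j g' where p: "p = (j, g')" and j: "j \<in> I" and g': "g' \<in> Hom B X (F j)"
      and fac': "Comp B (\<iota> j) g' = f"
      by (cases p) auto
    have eq: "fn (\<kappa> j) (fn g' y) = fn (\<kappa> i) (fn g y)" if "y \<in> und X" for y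
    proof -
      have "Comp B (\<kappa> j) g' = Comp B (\<kappa> i) g"
        using assoc[OF g' \<iota>[OF j] u] assoc[OF g \<iota>[OF i] u] u\<iota> i j fac fac' by simp
      then show ?thesis
        using Comp_app[OF g' that] Comp_app[OF g that] by metis
    qed
    \<comment> \<open>The point \<open>x\<close> decides this: its image lies in both summands, and
      distinct summands are disjoint. An empty object would factor through every inclusion.\<close>
    have "j = i"
      by (rule disj[OF j i Hom_app[OF g' x] Hom_app[OF g x] eq[OF x]])
    moreover have "g' = g"
      using g' g eq inj[OF i] \<open>j = i\<close> Hom_app[OF g] Hom_app[OF g']
      by (intro Hom_eqI[of g' X "F i" g]) (auto simp: inj_on_eq_iff)
    ultimately show "p = (i, g)"
      by (simp add: p)
  qed
qed

section \<open>Induced substructures and connected components\<close>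

definition sub :: "'o \<Rightarrow> 'u set \<Rightarrow> 'o" where
  "sub X S = (SOME Y. Y \<in> obs \<and> und Y = S \<and> rels Y = {(R, xs) \<in> rels X. set xs \<subseteq> S})"

definition incl :: "'o \<Rightarrow> 'u set \<Rightarrow> ('o, 'u) arrow" where
  "incl X S = \<lparr>src = sub X S, tgt = X, fn = restrict (\<lambda>x. x) S\<rparr>"

lemma sub:
  assumes "X \<in> obs" "S \<subseteq> und X"
  shows "sub X S \<in> obs" "und (sub X S) = S" "rels (sub X S) = {(R, xs) \<in> rels X. set xs \<subseteq> S}"
proof -
  have "\<exists>Y. Y \<in> obs \<and> und Y = S \<and> rels Y = {(R, xs) \<in> rels X. set xs \<subseteq> S}"
    using induced[OF assms] by blast
  from someI_ex[OF this]
  show "sub X S \<in> obs" "und (sub X S) = S" "rels (sub X S) = {(R, xs) \<in> rels X. set xs \<subseteq> S}"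
    unfolding sub_def by auto
qed

lemma push_incl:
  assumes "X \<in> obs" "S \<subseteq> und X"
  shows "push (fn (incl X S)) (rels (sub X S)) = {(R, xs) \<in> rels X. set xs \<subseteq> S}"
  using push_cong[OF sub(1)[OF assms], of "fn (incl X S)" "\<lambda>x. x"]
  by (simp add: sub[OF assms] push_ident incl_def)

lemma incl_Hom:
  assumes "X \<in> obs" "S \<subseteq> und X"
  shows "incl X S \<in> Hom B (sub X S) X"
  unfolding Hom_iff using assms push_incl[OF assms] sub[OF assms] by (auto simp: incl_def)

text \<open>No tuple is lost when X is cut into separated pieces: the head of a tuple lies in some
  piece, and separatedness puts the whole tuple there.\<close>

lemma separated_partition:
  assumes X: "X \<in> obs" and S: "\<And>i. i \<in> I \<Longrightarrow> separated X (S i)"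
    and disj: "\<And>i j x. i \<in> I \<Longrightarrow> j \<in> I \<Longrightarrow> x \<in> S i \<Longrightarrow> x \<in> S j \<Longrightarrow> i = j"
    and un: "und X = (\<Union>i\<in>I. S i)"
  shows "is_coproduct B I (\<lambda>i. sub X (S i)) X (\<lambda>i. incl X (S i))"
proof (rule disjoint_union_coproduct)
  have sub_X: "S i \<subseteq> und X" if "i \<in> I" for i
    using S[OF that] by (simp add: separated_def)
  have "rels X = (\<Union>i\<in>I. {(R, xs) \<in> rels X. set xs \<subseteq> S i})"
  proof (intro equalityI subsetI)
    fix p assume p: "p \<in> rels X"
    obtain R xs where [simp]: "p = (R, xs)"
      by (cases p)
    have xs: "hd xs \<in> set xs" "set xs \<subseteq> und X"
      using tuple[OF X, of R xs] p by auto
    then obtain i where "i \<in> I" "hd xs \<in> S i"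
      using un by blast
    then have "set xs \<subseteq> S i"
      using S[of i] xs p unfolding separated_def by fastforce
    then show "p \<in> (\<Union>i\<in>I. {(R, xs) \<in> rels X. set xs \<subseteq> S i})"
      using p \<open>i \<in> I\<close> by auto
  qed auto
  then have "rels X = (\<Union>i\<in>I. push (fn (incl X (S i))) (rels (sub X (S i))))"
    using push_incl[OF X sub_X] by simp
  then show "disjoint_union I (\<lambda>i. sub X (S i)) X (\<lambda>i. incl X (S i))"
    unfolding disjoint_union_def using X incl_Hom[OF X sub_X] sub(2)[OF X sub_X] disj un
    by (auto simp: incl_def inj_on_def)
qed

text \<open>This is the connected component of x in the Gaifman graph, obtained as the least
  separated set around x so that no paths have to be introduced.\<close>

definition component :: "'o \<Rightarrow> 'u \<Rightarrow> 'u set" where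
  "component X x = \<Inter>{S. separated X S \<and> x \<in> S}"

lemma component:
  assumes "X \<in> obs" "x \<in> und X"
  shows "separated X (component X x)" "x \<in> component X x"
    "separated X S \<Longrightarrow> x \<in> S \<Longrightarrow> component X x \<subseteq> S"
proof -
  show "separated X (component X x)"
    unfolding component_def using separated_und[OF assms(1)] assms(2)
    by (intro separated_Inter) auto
qed (auto simp: component_def)

text \<open>Separated sets are closed under difference. If S missed x, removing it from the
  component would leave a smaller separated set around x.\<close>

lemma component_minimal:
  assumes X: "X \<in> obs" "x \<in> und X" and S: "separated X S" "S \<subseteq> component X x" "S \<noteq> {}"
  shows "S = component X x"
proof (rule ccontr)
  assume "S \<noteq> component X x"
  have "x \<in> S"
  proof (rule ccontr)
    assume "x \<notin> S"
    then have "component X x \<subseteq> component X x - S"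
      using component[OF X] separated_Diff[OF X(1) _ S(1)] by blast
    then show False
      using S by blast
  qed
  then show False
    using component(3)[OF X S(1)] S(2) \<open>S \<noteq> component X x\<close> by blast
qed

text \<open>The component of y is a nonempty separated subset of the component of x, so minimality
  applies. It follows that components partition the underlying set.\<close>

lemma component_eq:
  assumes X: "X \<in> obs" "x \<in> und X" "y \<in> component X x"
  shows "component X y = component X x"
proof (rule component_minimal[OF X(1,2)])
  have y: "y \<in> und X"
    using component(1)[OF X(1,2)] X(3) by (auto simp: separated_def)
  show "separated X (component X y)" "component X y \<noteq> {}"
    "component X y \<subseteq> component X x"
    using component[OF X(1) y] component(1)[OF X(1,2)] X(3) by auto
qed

text \<open>Sets separated inside the component are separated in X: a tuple of X either lies in the
  component, hence belongs to the induced object, or misses the component and so also S. Minimality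
  then leaves only the trivial choices.\<close>

lemma component_connected:
  assumes X: "X \<in> obs" "x \<in> und X"
  shows "connected_ob small B (sub X (component X x))"
proof -
  have C: "separated X (component X x)"
    using component(1)[OF X] .
  then have C_sub: "component X x \<subseteq> und X"
    by (simp add: separated_def)
  note s = sub[OF X(1) C_sub]
  show ?thesis
  proof (rule connected_if_indecomposable[OF s(1)])
    show "und (sub X (component X x)) \<noteq> {}"
      using component(2)[OF X] s(2) by auto
    fix S assume S: "separated (sub X (component X x)) S"
    have "separated X S"
      unfolding separated_def
    proof (intro conjI ballI)
      show "S \<subseteq> und X"
        using S C_sub by (auto simp: separated_def s)
      fix p assume p: "p \<in> rels X"
      then show "case p of (R, xs) \<Rightarrow> set xs \<subseteq> S \<or> set xs \<inter> S = {}"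
        using S C unfolding separated_def s by (cases p) fast
    qed
    then show "S = {} \<or> S = und (sub X (component X x))"
      using component_minimal[OF X, of S] S by (auto simp: separated_def s)
  qed
qed

lemma component_based_obs:
  assumes "component_based B \<Delta>" "X \<in> \<Delta>"
  shows "X \<in> obs \<and> finite (und X)"
  using subsetD[OF assms(1)[unfolded component_based_def, THEN conjunct1] assms(2)]
  by (simp add: fin_ob_def)

lemma component_based_summand:
  assumes "component_based B \<Delta>" "P \<in> \<Delta>"
    and "is_coproduct B (UNIV :: bool set) (\<lambda>b. if b then X else Y) P \<iota>"
  shows "X \<in> \<Delta>"
proof -
  have "\<forall>X Y P \<iota>. is_coproduct B (UNIV :: bool set) (\<lambda>b. if b then X else Y) P \<iota> \<and> P \<in> \<Delta>
        \<longrightarrow> X \<in> \<Delta> \<and> Y \<in> \<Delta>"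
    by (rule assms(1)[unfolded component_based_def, THEN conjunct2, THEN conjunct2, THEN conjunct2])
  then show ?thesis
    using assms(2,3) by blast
qed

text \<open>The complement of S is separated too, so X is the binary coproduct of the objects
  induced on S and on its complement, and closure of \<open>\<Delta>\<close> under summands
  applies.\<close>

lemma separated_summand:
  assumes \<Delta>: "component_based B \<Delta>" and X: "X \<in> \<Delta>" and S: "separated X S"
  shows "sub X S \<in> \<Delta>"
proof -
  have Xob: "X \<in> obs"
    using component_based_obs[OF \<Delta> X] by blast
  have "is_coproduct B (UNIV :: bool set) (\<lambda>b. sub X (if b then S else und X - S)) X
      (\<lambda>b. incl X (if b then S else und X - S))"
    using S separated_Diff[OF Xob separated_und[OF Xob] S]
    by (intro separated_partition Xob) (auto split: if_splits simp: separated_def UNIV_bool)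
  then have "is_coproduct B (UNIV :: bool set) (\<lambda>b. if b then sub X S else sub X (und X - S)) X
      (\<lambda>b. incl X (if b then S else und X - S))"
    by (simp add: if_distrib[of "sub X"] cong: if_cong)
  then show ?thesis
    by (rule component_based_summand[OF \<Delta> X])
qed

text \<open>Gluing a family with one member along \<open>e\<close> gives an isomorphic copy on the
  image of \<open>e\<close>. The index \<open>undefined\<close> stands for an arbitrary element of
  \<open>'u\<close>.\<close>

lemma transport:
  assumes X: "X \<in> obs" and e: "inj_on e (und X)"
  shows "\<exists>Y. isomorphic B X Y \<and> Y \<in> obs \<and> und Y = e ` und X"
proof -
  have "small (e ` und X)"
    using small_lepoll[OF small_und[OF X] image_lepoll] .
  then obtain Y where Y: "Y \<in> obs" "und Y = e ` und X" "rels Y = push e (rels X)"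
    using glue[of "e ` und X" "{undefined}" "\<lambda>_. X" "\<lambda>_. e"] X e by auto
  define f where "f = \<lparr>src = X, tgt = Y, fn = restrict e (und X)\<rparr>"
  define g where "g = \<lparr>src = Y, tgt = X, fn = restrict (inv_into (und X) e) (und Y)\<rparr>"
  have f: "f \<in> Hom B X Y"
    unfolding f_def by (rule restrict_Hom) (use X Y in auto)
  have "push (inv_into (und X) e) (rels Y) = push (\<lambda>x. x) (rels X)"
    unfolding Y(3) push_push by (rule push_cong[OF X]) (simp add: e)
  then have g: "g \<in> Hom B Y X"
    unfolding g_def by (intro restrict_Hom X Y(1)) (use Y e in \<open>auto simp: push_ident\<close>)
  have "Comp B g f = Ident B X"
    by (rule Hom_eqI[OF Comp_Hom[OF f g] Ident_Hom[OF X]])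
      (use Comp_app[OF f] e Y(2) in \<open>auto simp: f_def g_def fn_Ident\<close>)
  moreover have "Comp B f g = Ident B Y"
    by (rule Hom_eqI[OF Comp_Hom[OF g f] Ident_Hom[OF Y(1)]])
      (use Comp_app[OF g] e Y(2) in \<open>auto simp: f_def g_def fn_Ident\<close>)
  ultimately show ?thesis
    using f g Y unfolding isomorphic_def by blast
qed

section \<open>The representatives, their number, and the decomposition of objects of the
  class\<close>

context
  fixes \<Delta> \<A> :: "'o set"
  assumes \<Delta>: "component_based B \<Delta>" and \<A>: "connected_representatives small B \<Delta> \<A>"
begin

lemma \<A>_connected: "A \<in> \<A> \<Longrightarrow> A \<in> \<Delta> \<and> connected_ob small B A"
  using \<A> by (simp add: connected_representatives_def)

lemma \<A>_unique: "X \<in> \<Delta> \<Longrightarrow> connected_ob small B X \<Longrightarrow> \<exists>!A. A \<in> \<A> \<and> isomorphic B X A"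
  using \<A> by (simp add: connected_representatives_def)

lemma \<A>_finite: "A \<in> \<A> \<Longrightarrow> A \<in> obs \<and> finite (und A)"
  using \<A>_connected component_based_obs[OF \<Delta>] by blast

lemma tiny_\<A>: "tiny \<A>"
proof -
  obtain M where M: "infinite (M :: 'u set)"
    using ex_infinite_small by blast
  obtain N where N: "N \<subseteq> M" "infinite N" "countable N"
    using infinite_countable_subset'[OF M] by blast
  have "\<exists>Y. isomorphic B A Y \<and> Y \<in> {X \<in> obs. finite (und X) \<and> und X \<subseteq> N}" if "A \<in> \<A>" for A
  proof -
    have A: "A \<in> obs" "finite (und A)"
      using \<A>_finite[OF that] by auto
    obtain e where e: "inj_on e (und A)" "e ` und A \<subseteq> N"
      using finite_lepoll_infinite[OF N(2) A(2)] unfolding lepoll_def by blast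
    obtain Y where Y: "isomorphic B A Y" "Y \<in> obs" "und Y = e ` und A"
      using transport[OF A(1) e(1)] by blast
    then have "Y \<in> {X \<in> obs. finite (und X) \<and> und X \<subseteq> N}"
      using A(2) e(2) by simp
    then show ?thesis
      using Y(1) by blast
  qed
  then obtain t where t: "\<And>A. A \<in> \<A> \<Longrightarrow> isomorphic B A (t A) \<and>
      t A \<in> {X \<in> obs. finite (und X) \<and> und X \<subseteq> N}"
    by metis
  have "inj_on t \<A>"
  proof (rule inj_onI)
    fix A A' assume A: "A \<in> \<A>" "A' \<in> \<A>" "t A = t A'"
    \<comment> \<open>Both isomorphisms pass through the common copy \<open>t A\<close>. They
      exhibit \<open>A\<close> and \<open>A'\<close> as representatives of the same object
      \<open>A\<close>, so uniqueness identifies them.\<close>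
    have "isomorphic B A A'" "isomorphic B A A"
      using t[OF A(1)] t[OF A(2)] A(3) isomorphic_sym isomorphic_trans by metis+
    then show "A = A'"
      using \<A>_unique \<A>_connected[OF A(1)] A(1,2) by blast
  qed
  moreover have "tiny (t ` \<A>)"
    by (rule tiny_subset[OF few[OF N(3)]]) (use t in blast)
  ultimately show ?thesis
    by (rule tiny_inj)
qed

text \<open>Representatives are finite, so the arrows from one of them into X form a tiny set even
  when X is infinite; there are only tiny many representatives to sum over.\<close>

lemma tiny_density_index:
  assumes X: "X \<in> obs"
  shows "tiny (density_index B \<A> X)"
proof -
  have "tiny (Hom B A X)" if A: "A \<in> \<A>" for A
  proof (rule tiny_inj)
    show "inj_on fn (Hom B A X)"
      by (rule inj_onI) (auto intro: Hom_eqI)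
    have "fn ` Hom B A X \<subseteq> und A \<rightarrow>\<^sub>E und X"
      using HomD(5) by blast
    then show "tiny (fn ` Hom B A X)"
      using tiny_PiE \<A>_finite[OF A] small_und[OF X] tiny_iff_small tiny_subset by metis
  qed
  then have "tiny (\<Union>A\<in>\<A>. Hom B A X)"
    by (rule tiny_UN[OF tiny_\<A>])
  moreover have "density_index B \<A> X \<subseteq> (\<Union>A\<in>\<A>. Hom B A X)"
    by (auto simp: density_index_def Hom_def)
  ultimately show ?thesis
    by (rule tiny_subset)
qed

lemma density: "density B \<A>"
proof
  fix X assume "X \<in> Ob B"
  then have "\<exists>P \<iota>. disjoint_union (density_index B \<A> X) src P \<iota>"
    using \<A>_finite
    by (intro ex_disjoint_union tiny_density_index) (auto simp: density_index_def)
  then show "\<exists>P \<iota>. is_coproduct B (density_index B \<A> X) (Dom B) P \<iota>"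
    using disjoint_union_coproduct by (simp only: Dom_B) blast
qed

lemma component_decomposition:
  assumes X: "X \<in> \<Delta>"
  shows "\<exists>(I :: 'u set set) k. (\<forall>i\<in>I. k i \<in> density_index B \<A> X) \<and>
    is_coproduct B I (\<lambda>i. Dom B (k i)) X k"
proof -
  have Xob: "X \<in> obs"
    using component_based_obs[OF \<Delta> X] by blast
  \<comment> \<open>Indexing by components instead of points counts each component once. Isomorphic
    components share a representative but keep separate indices. For empty X the family is empty,
    and X is its coproduct.\<close>
  define I where "I = component X ` und X"
  have sep: "separated X S" if "S \<in> I" for S
    using that component(1)[OF Xob] by (auto simp: I_def)
  then have sub_X: "S \<subseteq> und X" if "S \<in> I" for S
    using that by (auto simp: separated_def)
  have cop: "is_coproduct B I (sub X) X (incl X)"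
  proof (rule separated_partition[OF Xob sep])
    have "component X x = S" if "S \<in> I" "x \<in> S" for S x
      using that component_eq[OF Xob] unfolding I_def by blast
    then show "S = T" if "S \<in> I" "T \<in> I" "x \<in> S" "x \<in> T" for S T x
      using that by metis
    show "und X = (\<Union>S\<in>I. S)"
      using sub_X component(2)[OF Xob] by (auto simp: I_def)
  qed
  have "\<exists>A d e. A \<in> \<A> \<and> d \<in> Hom B (sub X S) A \<and> e \<in> Hom B A (sub X S) \<and>
      Comp B e d = Ident B (sub X S) \<and> Comp B d e = Ident B A" if S: "S \<in> I" for S
  proof -
    have "connected_ob small B (sub X S)"
      using S component_connected[OF Xob] by (auto simp: I_def)
    then obtain A where "A \<in> \<A>" "isomorphic B (sub X S) A"
      using \<A>_unique[OF separated_summand[OF \<Delta> X sep[OF S]]] by blast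
    then show ?thesis
      unfolding isomorphic_def by blast
  qed
  then obtain A d e where *: "\<And>S. S \<in> I \<Longrightarrow> A S \<in> \<A> \<and> d S \<in> Hom B (sub X S) (A S) \<and>
      e S \<in> Hom B (A S) (sub X S) \<and> Comp B (e S) (d S) = Ident B (sub X S) \<and>
      Comp B (d S) (e S) = Ident B (A S)"
    by metis
  let ?k = "\<lambda>S. Comp B (incl X S) (e S)"
  have "is_coproduct B I A X ?k"
    by (rule coproduct_iso_summands[OF cop]) (use * in blast)+
  moreover have "?k S \<in> Hom B (A S) X" if "S \<in> I" for S
    using Comp_Hom[OF _ incl_Hom[OF Xob sub_X[OF that]]] *[OF that] by blast
  ultimately show ?thesis
    using * by (intro exI[of _ I] exI[of _ ?k])
      (auto simp: density_index_def Hom_def is_coproduct_def)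
qed

theorem subset_iff_comonad_morphism:
  assumes C: "is_comonad B C" and \<Gamma>: "classifies B C \<Gamma>"
  shows "\<Delta> \<subseteq> \<Gamma> \<longleftrightarrow> (\<exists>\<tau>. comonad_morphism B (density_comonad B \<A>) C \<tau>)"
proof (rule iffI)
  have \<Gamma>_iff: "X \<in> \<Gamma> \<longleftrightarrow> (\<exists>\<alpha>. is_coalgebra B C X \<alpha>)" if "X \<in> \<Delta>" for X
  proof -
    have "X \<in> fin_ob B"
      using component_based_obs[OF \<Delta> that] by (simp add: fin_ob_def)
    then show ?thesis
      using \<Gamma> unfolding classifies_def by blast
  qed
  show "\<exists>\<tau>. comonad_morphism B (density_comonad B \<A>) C \<tau>" if "\<Delta> \<subseteq> \<Gamma>"
  proof -
    have "\<forall>A\<in>\<A>. \<exists>\<alpha>. is_coalgebra B C A \<alpha>"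
      using that \<A>_connected \<Gamma>_iff by blast
    then obtain \<alpha> where "\<And>A. A \<in> \<A> \<Longrightarrow> is_coalgebra B C A (\<alpha> A)"
      by metis
    then show ?thesis
      by (rule density.comonad_morphism_from_coalgebras[OF density C])
  qed
  show "\<Delta> \<subseteq> \<Gamma>" if ex: "\<exists>\<tau>. comonad_morphism B (density_comonad B \<A>) C \<tau>"
  proof
    fix X assume X: "X \<in> \<Delta>"
    obtain \<tau> where \<tau>: "comonad_morphism B (density_comonad B \<A>) C \<tau>"
      using ex by blast
    obtain I :: "'u set set" and k where k: "\<And>i. i \<in> I \<Longrightarrow> k i \<in> density_index B \<A> X"
      and cop: "is_coproduct B I (\<lambda>i. Dom B (k i)) X k"
      using component_decomposition[OF X] by blast
    show "X \<in> \<Gamma>"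
      unfolding \<Gamma>_iff[OF X]
      by (rule density.coalgebra_from_comonad_morphism[OF density C \<tau> k cop])
  qed
qed

end

end

section \<open>Structures and graphs\<close>

text \<open>A structure is determined by its underlying set and its set \<open>r X\<close> of
  labelled tuples, so it remains to bound the possible sets of tuples. The two cases are needed
  because over an infinite signature even a finite structure can have infinitely many
  tuples.\<close>

lemma (in small_sets) few_structures:
  fixes \<sigma> :: "'s set"
  assumes \<sigma>: "signature small \<sigma> ar" and N: "countable N"
  shows "tiny {X \<in> structures small \<sigma> ar. finite (univ X) \<and> univ X \<subseteq> N}" (is "tiny ?S")
proof -
  define r where "r X = {(R, xs). R \<in> \<sigma> \<and> xs \<in> rel X R}" for X :: "('s, 'u) struct"
  have r_sub: "r X \<subseteq> (SIGMA R:\<sigma>. {xs. set xs \<subseteq> univ X \<and> length xs = ar R})"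
    if "X \<in> structures small \<sigma> ar" for X
    using that by (auto simp: structures_def r_def)
  have "inj_on (\<lambda>X. (univ X, r X)) ?S"
  proof (rule inj_onI)
    fix X Y assume XY: "X \<in> ?S" "Y \<in> ?S" "(univ X, r X) = (univ Y, r Y)"
    have "rel X R = rel Y R" for R
    proof (cases "R \<in> \<sigma>")
      case True
      then have "rel X R = {xs. (R, xs) \<in> r X}" "rel Y R = {xs. (R, xs) \<in> r Y}"
        by (auto simp: r_def)
      then show ?thesis
        using XY(3) by simp
    next
      case False
      then show ?thesis
        using XY(1,2) by (simp add: structures_def)
    qed
    then show "X = Y"
      using XY(3) by (cases X, cases Y) auto
  qed
  moreover have "tiny (r ` ?S)"
  proof (cases "finite \<sigma>")
    \<comment> \<open>Finitely many symbols on a finite set admit finitely many tuples, so only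
      finite subsets of a countable set occur.\<close>
    case True
    have "finite (r X)" if "X \<in> ?S" for X
      by (rule finite_subset[OF r_sub])
        (use that True in \<open>auto intro: finite_lists_length_eq\<close>)
    then have "r ` ?S \<subseteq> {E. finite E \<and> E \<subseteq> \<sigma> \<times> lists N}"
      using r_sub by fast
    moreover have "tiny {E. finite E \<and> E \<subseteq> \<sigma> \<times> lists N}"
      using True N
      by (intro tiny_countable countable_Collect_finite_subset countable_SIGMA countable_lists)
        (auto intro: countable_finite)
    ultimately show ?thesis
      using tiny_subset by blast
  next
    \<comment> \<open>An infinite \<open>\<sigma>\<close> absorbs the countable factor
      \<open>lists N\<close>. Sets of labelled tuples are thereby encoded as subsets of
      \<open>\<sigma>\<close>, and \<open>Pow \<sigma>\<close> is bounded by a small set by the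
      definition of \<open>signature\<close>.\<close>
    case False
    have "lists N \<lesssim> (UNIV :: nat set)"
      using countable_lists[OF N] unfolding countable_def lepoll_def by blast
    also have "\<dots> \<lesssim> \<sigma>"
      using False infinite_le_lepoll by blast
    finally have "\<sigma> \<times> lists N \<lesssim> \<sigma> \<times> \<sigma>"
      by (rule times_lepoll_mono[OF lepoll_refl])
    also have "\<sigma> \<times> \<sigma> \<approx> \<sigma>"
      using card_of_Times_same_infinite[OF False] eqpoll_iff_card_of_ordIso by blast
    finally obtain f where f: "inj_on f (\<sigma> \<times> lists N)" "f ` (\<sigma> \<times> lists N) \<subseteq> \<sigma>"
      unfolding lepoll_def by blast
    have "tiny (Pow \<sigma>)"
      using \<sigma> by (simp add: signature_def tiny_def)
    then have "tiny (image f ` Pow (\<sigma> \<times> lists N))"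
      by (rule tiny_subset) (use f(2) in blast)
    then have "tiny (Pow (\<sigma> \<times> lists N))"
      using tiny_inj inj_on_image_Pow[OF f(1)] by blast
    moreover have "r ` ?S \<subseteq> Pow (\<sigma> \<times> lists N)"
      using r_sub by fast
    ultimately show ?thesis
      using tiny_subset by blast
  qed
  moreover have "tiny {A. finite A \<and> A \<subseteq> N}"
    by (intro tiny_countable countable_Collect_finite_subset N)
  ultimately show ?thesis
    using tiny_inj[of "\<lambda>X. (univ X, r X)"] tiny_times[of "{A. finite A \<and> A \<subseteq> N}" "r ` ?S"]
      tiny_subset[of "{A. finite A \<and> A \<subseteq> N} \<times> r ` ?S" "(\<lambda>X. (univ X, r X)) ` ?S"] by blast
qed

text \<open>The labels are the symbols of \<open>\<sigma>\<close>; positivity of the arities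
  provides the nonempty tuples on which the component arguments rest.\<close>

lemma relational_structures:
  fixes small :: "'u set \<Rightarrow> bool" and \<sigma> :: "'s set"
  assumes small: "universe small" and \<sigma>: "signature small \<sigma> ar"
  shows "relational small (structures small \<sigma> ar) univ
    (\<lambda>A. {(R, xs). R \<in> \<sigma> \<and> xs \<in> rel A R})
    (\<lambda>A B f. \<forall>R\<in>\<sigma>. \<forall>xs \<in> rel A R. map f xs \<in> rel B R)"
proof -
  interpret small_sets small
    by unfold_locales fact
  have rel_sub: "rel X R \<subseteq> {xs. set xs \<subseteq> univ X \<and> length xs = ar R}"
    if "X \<in> structures small \<sigma> ar" "R \<in> \<sigma>" for X :: "('s, 'u) struct" and R
    using that by (simp add: structures_def)
  show ?thesis
  proof unfold_locales
    show "small (univ X)" if "X \<in> structures small \<sigma> ar" for X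
      using that by (simp add: structures_def)
    show "xs \<noteq> [] \<and> set xs \<subseteq> univ X"
      if "X \<in> structures small \<sigma> ar" "(R, xs) \<in> {(R, xs). R \<in> \<sigma> \<and> xs \<in> rel X R}" for X R xs
    proof -
      have "R \<in> \<sigma>" "set xs \<subseteq> univ X" "length xs = ar R" "0 < ar R"
        using that rel_sub \<sigma> by (auto simp: signature_def)
      then show ?thesis
        by auto
    qed
    show "(\<forall>R\<in>\<sigma>. \<forall>xs\<in>rel X R. map f xs \<in> rel Y R) \<longleftrightarrow>
      push f {(R, xs). R \<in> \<sigma> \<and> xs \<in> rel X R} \<subseteq> {(R, xs). R \<in> \<sigma> \<and> xs \<in> rel Y R}"
      for X Y :: "('s, 'u) struct" and f
      by (auto simp: push_def)
    show "\<exists>P\<in>structures small \<sigma> ar. univ P = U \<and> {(R, xs). R \<in> \<sigma> \<and> xs \<in> rel P R} =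
        (\<Union>i\<in>I. push (j i) {(R, xs). R \<in> \<sigma> \<and> xs \<in> rel (F i) R})"
      if U: "small U" and F: "\<And>i. i \<in> I \<Longrightarrow> F i \<in> structures small \<sigma> ar \<and>
        inj_on (j i) (univ (F i)) \<and> j i ` univ (F i) \<subseteq> U"
      for U and I :: "'u set" and F j
    proof
      \<comment> \<open>The default \<open>{}\<close> is the interpretation that
        \<open>structures\<close> prescribes for symbols outside \<open>\<sigma>\<close>.\<close>
      let ?P = "\<lparr>univ = U, rel = \<lambda>R. if R \<in> \<sigma> then \<Union>i\<in>I. map (j i) ` rel (F i) R else {}\<rparr>"
      have tup: "map (j i) xs \<in> {xs. set xs \<subseteq> U \<and> length xs = ar R}"
        if "i \<in> I" "R \<in> \<sigma>" "xs \<in> rel (F i) R" for i R xs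
        using F[OF that(1)] rel_sub[of "F i" R] that(2,3) by fastforce
      have "(\<Union>i\<in>I. map (j i) ` rel (F i) R) \<subseteq> {xs. set xs \<subseteq> U \<and> length xs = ar R}"
        if R: "R \<in> \<sigma>" for R
        by (intro UN_least image_subsetI tup R)
      then show "?P \<in> structures small \<sigma> ar"
        using U by (simp add: structures_def)
      show "univ ?P = U \<and> {(R, xs). R \<in> \<sigma> \<and> xs \<in> rel ?P R} =
        (\<Union>i\<in>I. push (j i) {(R, xs). R \<in> \<sigma> \<and> xs \<in> rel (F i) R})"
        unfolding push_def image_iff by (auto simp: image_iff) blast+
    qed
    show "\<exists>Y\<in>structures small \<sigma> ar. univ Y = S \<and> {(R, xs). R \<in> \<sigma> \<and> xs \<in> rel Y R} =
        {(R, xs) \<in> {(R, xs). R \<in> \<sigma> \<and> xs \<in> rel X R}. set xs \<subseteq> S}"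
      if X: "X \<in> structures small \<sigma> ar" and S: "S \<subseteq> univ X" for X S
    proof
      let ?Y = "\<lparr>univ = S, rel = \<lambda>R. {xs \<in> rel X R. set xs \<subseteq> S}\<rparr>"
      show "?Y \<in> structures small \<sigma> ar"
        using X small_subset[OF _ S] by (auto simp: structures_def)
    qed auto
    show "tiny {X \<in> structures small \<sigma> ar. finite (univ X) \<and> univ X \<subseteq> N}" if "countable N" for N
      by (rule few_structures[OF \<sigma> that])
  qed
qed

lemma relational_graphs:
  fixes small :: "'u set \<Rightarrow> bool"
  assumes small: "universe small"
  shows "relational small (graphs small) verts (\<lambda>G. (\<lambda>(x, y). ((), [x, y])) ` edges G)
    (\<lambda>G H f. \<forall>(x, y) \<in> edges G. (f x, f y) \<in> edges H)"
proof -
  interpret small_sets small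
    by unfold_locales fact
  show ?thesis
  proof unfold_locales
    show "small (verts X)" if "X \<in> graphs small" for X
      using that by (simp add: graphs_def)
    show "xs \<noteq> [] \<and> set xs \<subseteq> verts X"
      if "X \<in> graphs small" "(R, xs) \<in> (\<lambda>(x, y). ((), [x, y])) ` edges X" for X R xs
      using that by (auto simp: graphs_def)
    show "(\<forall>(x, y)\<in>edges X. (f x, f y) \<in> edges Y) \<longleftrightarrow>
      push f ((\<lambda>(x, y). ((), [x, y])) ` edges X) \<subseteq> (\<lambda>(x, y). ((), [x, y])) ` edges Y"
      for X Y :: "'u graph" and f
      by (fastforce simp: push_def)
    show "\<exists>P\<in>graphs small. verts P = U \<and> (\<lambda>(x, y). ((), [x, y])) ` edges P =
        (\<Union>i\<in>I. push (j i) ((\<lambda>(x, y). ((), [x, y])) ` edges (F i)))"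
      if U: "small U" and F: "\<And>i. i \<in> I \<Longrightarrow> F i \<in> graphs small \<and>
        inj_on (j i) (verts (F i)) \<and> j i ` verts (F i) \<subseteq> U"
      for U and I :: "'u set" and F j
    proof
      let ?E = "\<Union>i\<in>I. (\<lambda>(x, y). (j i x, j i y)) ` edges (F i)"
      let ?P = "\<lparr>verts = U, edges = ?E\<rparr>"
      have E: "x \<in> verts (F i) \<and> y \<in> verts (F i) \<and> (y, x) \<in> edges (F i) \<and> x \<noteq> y"
        if "i \<in> I" "(x, y) \<in> edges (F i)" for i x y
        using F[OF that(1)] that(2) by (auto simp: graphs_def irrefl_def dest: symD)
      have "?E \<subseteq> U \<times> U"
        using E F by fastforce
      moreover have "sym ?E"
        using E by (force intro!: symI)
      \<comment> \<open>Injectivity of \<open>j i\<close> enters here: a loop in the glued graph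
        could arise only from an edge whose two distinct ends are identified.\<close>
      moreover have "irrefl ?E"
        using E F by (fastforce simp: irrefl_def inj_on_def)
      ultimately show "?P \<in> graphs small"
        using U by (simp add: graphs_def)
      show "verts ?P = U \<and> (\<lambda>(x, y). ((), [x, y])) ` edges ?P =
        (\<Union>i\<in>I. push (j i) ((\<lambda>(x, y). ((), [x, y])) ` edges (F i)))"
        by (simp add: push_def image_UN image_image case_prod_beta)
    qed
    show "\<exists>Y\<in>graphs small. verts Y = S \<and> (\<lambda>(x, y). ((), [x, y])) ` edges Y =
        {(R, xs) \<in> (\<lambda>(x, y). ((), [x, y])) ` edges X. set xs \<subseteq> S}"
      if X: "X \<in> graphs small" and S: "S \<subseteq> verts X" for X S
    proof
      let ?Y = "\<lparr>verts = S, edges = edges X \<inter> S \<times> S\<rparr>"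
      show "?Y \<in> graphs small"
        using X small_subset[OF _ S] by (auto simp: graphs_def sym_def irrefl_def)
    qed auto
    show "tiny {X \<in> graphs small. finite (verts X) \<and> verts X \<subseteq> N}" if N: "countable N" for N
    proof (rule tiny_inj)
      show "inj_on (\<lambda>X. (verts X, edges X)) {X \<in> graphs small. finite (verts X) \<and> verts X \<subseteq> N}"
        by (intro inj_onI) (auto intro: graph.equality)
      have "finite (edges X)" if "X \<in> graphs small" "finite (verts X)" for X
        using that finite_subset[of "edges X" "verts X \<times> verts X"] by (simp add: graphs_def)
      then have "(\<lambda>X. (verts X, edges X)) ` {X \<in> graphs small. finite (verts X) \<and> verts X \<subseteq> N} \<subseteq>
          {A. finite A \<and> A \<subseteq> N} \<times> {E. finite E \<and> E \<subseteq> N \<times> N}"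
        by (auto simp: graphs_def)
      moreover have "countable ({A. finite A \<and> A \<subseteq> N} \<times> {E. finite E \<and> E \<subseteq> N \<times> N})"
        by (intro countable_SIGMA countable_Collect_finite_subset N)
      ultimately show "tiny ((\<lambda>X. (verts X, edges X)) `
          {X \<in> graphs small. finite (verts X) \<and> verts X \<subseteq> N})"
        by (rule tiny_countable[OF countable_subset])
    qed
  qed
qed

theorem proposition5p3:
  fixes small :: "'u set \<Rightarrow> bool" and \<sigma> :: "'s set" and ar :: "'s \<Rightarrow> nat"
  assumes "universe small" and "signature small \<sigma> ar"
  shows
    "(\<forall>\<Delta> \<A> C \<Gamma>.
        component_based (Str small \<sigma> ar) \<Delta> \<and>
        connected_representatives small (Str small \<sigma> ar) \<Delta> \<A> \<and>
        is_comonad (Str small \<sigma> ar) C \<and>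
        classifies (Str small \<sigma> ar) C \<Gamma> \<longrightarrow>
        (\<Delta> \<subseteq> \<Gamma> \<longleftrightarrow>
          (\<exists>\<tau>. comonad_morphism (Str small \<sigma> ar) (density_comonad (Str small \<sigma> ar) \<A>) C \<tau>)))
     \<and>
     (\<forall>\<Delta> \<A> C \<Gamma>.
        component_based (Graph small) \<Delta> \<and>
        connected_representatives small (Graph small) \<Delta> \<A> \<and>
        is_comonad (Graph small) C \<and>
        classifies (Graph small) C \<Gamma> \<longrightarrow>
        (\<Delta> \<subseteq> \<Gamma> \<longleftrightarrow>
          (\<exists>\<tau>. comonad_morphism (Graph small) (density_comonad (Graph small) \<A>) C \<tau>)))"
  unfolding Str_def Graph_def
  using relational.subset_iff_comonad_morphism[OF relational_structures[OF assms]]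
    relational.subset_iff_comonad_morphism[OF relational_graphs[OF assms(1)]]
  by (intro conjI allI impI; elim conjE) assumption+

end
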